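(* Let $f\in C([0,1])$ be of type A, B or C, with $f(0)=f(1)=0$ and with some $k>0$ such that $|f(s)|\le ks$ and $|f(s)|\le k(1-s)$ for every $s\in[0,1]$. For every $\gamma>0$, let $c^*_\gamma$ be the critical speed for $$\gamma\left(\frac{v'}{\sqrt{1-\gamma^2(v')^2}}\right)'-c\,v'+f(v)=0,\qquad(\ast)$$ and let $v_\gamma$ be the unique heteroclinic solution of $(\ast)$ with $c=c^*_\gamma$, connecting $0$ and $1$, satisfying $v_\gamma(0)=\mathcal{V}_0$. Write $F(1)=\int_0^1f(s)\,ds$. The following hold: 1. if $F(1)>0$, then $\lim_{\gamma\to+\infty}c^*_\gamma=+\infty$, where the convergence occurs monotonically and with order $\gamma$; 2. if $F(1)=0$, then $\lim_{\gamma\to+\infty}c^*_\gamma=0$. In both cases, $$\lim_{\gamma\to+\infty}v_\gamma=\mathcal{V}_0\quad\text{in }C^2_{\mathrm{loc}}(\mathbb{R}),$$ that is, with $C^2$ convergence on compact subsets of $\mathbb{R}$ (to the constant function $\mathcal{V}_0$).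
   Context: Types of reaction terms $f$: - type A: $f(u)>0$ for every $u\in(0,1)$; - type B: there exists $\alpha\in(0,1)$ with $f(u)=0$ for $u\in[0,\alpha]$ and $f(u)>0$ for $u\in(\alpha,1)$; - type C: there exists $\alpha\in(0,1)$ with $f<0$ on $(0,\alpha)$ and $f>0$ on $(\alpha,1)$, and moreover $\int_0^1 f(s)\,ds\ge 0$. Normalization value: $\mathcal{V}_0=1/2$ if $f$ is of type A, $\mathcal{V}_0=\alpha$ if $f$ is of type B or C. A heteroclinic solution (connecting $0$ and $1$) of $(\ast)$ is a monotone $C^2$ solution $v:\mathbb{R}\to[0,1]$ (with $\gamma|v'|<1$) such that $v(-\infty)=0$, $v(+\infty)=1$. The speeds $c\in\mathbb{R}$ for which such a solution exists (equivalently, for which the problem $y'=c\,a\,\frac{\sqrt{y(2a+y)}}{a+y}-f(v)$ with $a=1/\gamma$, $y(0)=y(1)=0$, $y>0$ on $(0,1)$, is solvable) form an interval $[c^*_\gamma,+\infty)$ if $f$ is of type A and a singleton $\{c^*_\gamma\}$ if $f$ is of type B or C; $c^*_\gamma$ is the critical speed, and the corresponding heteroclinic is unique up to translations in $z$. "With order $\gamma$" means that there are constants $0<C_1\le C_2$ with $C_1\gamma\le c^*_\gamma\le C_2\gamma$ for all sufficiently large $\gamma$; "monotonically" means that $\gamma\mapsto c^*_\gamma$ is monotone. *)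

theory Defs
  imports "HOL-Analysis.Analysis"
begin

definition type_A :: "(real \<Rightarrow> real) \<Rightarrow> bool" where
  "type_A f \<longleftrightarrow> (\<forall>u\<in>{0<..<1}. f u > 0)"

text \<open>In types B and C the threshold \<open>\<alpha>\<close> is an explicit argument; it is determined by \<open>f\<close>.\<close>

definition type_B :: "(real \<Rightarrow> real) \<Rightarrow> real \<Rightarrow> bool" where
  "type_B f \<alpha> \<longleftrightarrow> \<alpha> \<in> {0<..<1} \<and> (\<forall>u\<in>{0..\<alpha>}. f u = 0) \<and> (\<forall>u\<in>{\<alpha><..<1}. f u > 0)"

definition type_C :: "(real \<Rightarrow> real) \<Rightarrow> real \<Rightarrow> bool" where
  "type_C f \<alpha> \<longleftrightarrow> \<alpha> \<in> {0<..<1} \<and> (\<forall>u\<in>{0<..<\<alpha>}. f u < 0) \<and> (\<forall>u\<in>{\<alpha><..<1}. f u > 0)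
     \<and> integral {0..1} f \<ge> 0"

definition C2 :: "(real \<Rightarrow> real) \<Rightarrow> bool" where
  "C2 v \<longleftrightarrow> (\<forall>z. v differentiable (at z)) \<and> (\<forall>z. deriv v differentiable (at z))
     \<and> continuous_on UNIV (deriv (deriv v))"

text \<open>Given \<open>C2 v\<close> and \<open>\<gamma> * \<bar>deriv v z\<bar> < 1\<close>, the flux below is differentiable, so its
  \<open>deriv\<close> is a genuine derivative. The limits rule out nonincreasing profiles, so
  ``monotone'' is \<open>mono\<close>.\<close>

definition heteroclinic :: "(real \<Rightarrow> real) \<Rightarrow> real \<Rightarrow> real \<Rightarrow> (real \<Rightarrow> real) \<Rightarrow> bool" where
  "heteroclinic f \<gamma> c v \<longleftrightarrow>
     C2 v \<and> mono v \<and> (\<forall>z. v z \<in> {0..1}) \<and> (\<forall>z. \<gamma> * \<bar>deriv v z\<bar> < 1) \<and>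
     (\<forall>z. \<gamma> * deriv (\<lambda>x. deriv v x / sqrt (1 - \<gamma>\<^sup>2 * (deriv v x)\<^sup>2)) z
            - c * deriv v z + f (v z) = 0) \<and>
     (v \<longlongrightarrow> 0) at_bot \<and> (v \<longlongrightarrow> 1) at_top"

definition admissible_speeds :: "(real \<Rightarrow> real) \<Rightarrow> real \<Rightarrow> real set" where
  "admissible_speeds f \<gamma> = {c. \<exists>v. heteroclinic f \<gamma> c v}"

definition critical_speed :: "(real \<Rightarrow> real) \<Rightarrow> real \<Rightarrow> real \<Rightarrow> bool" where
  "critical_speed f \<gamma> c \<longleftrightarrow>
     (type_A f \<longrightarrow> admissible_speeds f \<gamma> = {c..}) \<and>
     ((\<exists>\<alpha>. type_B f \<alpha> \<or> type_C f \<alpha>) \<longrightarrow> admissible_speeds f \<gamma> = {c})"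

definition C2_loc_limit ::
    "('i \<Rightarrow> real \<Rightarrow> real) \<Rightarrow> (real \<Rightarrow> real) \<Rightarrow> 'i filter \<Rightarrow> bool" where
  "C2_loc_limit v w \<F> \<longleftrightarrow> (\<forall>K. compact K \<longrightarrow>
     uniform_limit K v w \<F> \<and>
     uniform_limit K (\<lambda>i. deriv (v i)) (deriv w) \<F> \<and>
     uniform_limit K (\<lambda>i. deriv (deriv (v i))) (deriv (deriv w)) \<F>)"

end

theory Submission imports Defs begin

text \<open>
  A front is described by its kinetic energy \<open>E = (1 / sqrt (1 - (\<gamma> v')\<^sup>2) - 1) / \<gamma>\<close>, which satisfies
  \<open>E' = v' (c v' - f v)\<close> and tends to \<open>0\<close> at \<open>\<plusminus>\<infinity>\<close>. Integrating this identity over the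
  line gives \<open>c \<integral> v'\<^sup>2 = \<integral> f\<close>, where the integral of \<open>f\<close> is over \<open>[0, 1]\<close>. Hence \<open>c \<ge> 0\<close>, and \<open>c = 0\<close> for every
  \<open>\<gamma>\<close> if \<open>f\<close> has mean zero. Since \<open>0 \<le> v' < 1 / \<gamma>\<close>, it also gives \<open>c \<ge> \<gamma> \<integral> f\<close>, the lower
  bound of order \<open>\<gamma>\<close>.

  Monotonicity and the upper bound come from the first order reduction. Fronts are strictly increasing
  where \<open>0 < v < 1\<close>, so the energy is a function \<open>y\<close> of the value of the front; it solves
  \<open>y' = c * slope \<gamma> y - f\<close> on \<open>(0, 1)\<close> with \<open>y 0 = y 1 = 0\<close>. The critical speed turns out to
  be monotone in the drift term: if \<open>c2 * slope \<gamma>2 \<le> c1 * slope \<gamma>1\<close> and \<open>c2\<close> is the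
  critical speed at \<open>\<gamma>2\<close>, then the critical speed at \<open>\<gamma>1\<close> is at most \<open>c1\<close>. For types B and C
  this follows by comparing two profiles at both end points (\<open>profiles_speed_comparison\<close>). For type
  A a profile at \<open>\<gamma>1\<close> with speed \<open>c1\<close> has to be constructed (\<open>ex_profile_of_subsolution\<close>) and turned
  back into a front (\<open>heteroclinic_of_profile\<close>). Now \<open>slope \<gamma> y\<close> is nonincreasing in \<open>\<gamma>\<close> and
  \<open>\<gamma> * slope \<gamma> y\<close> is nondecreasing, so the critical speed is nondecreasing in \<open>\<gamma>\<close>, and its quotient
  by \<open>\<gamma>\<close> is nonincreasing. The latter yields the upper bound \<open>c \<gamma> \<le> c 1 * \<gamma>\<close> for \<open>\<gamma> \<ge> 1\<close>.

  Finally \<open>\<bar>v'\<bar> \<le> 1 / \<gamma>\<close>, and the equation shows that \<open>\<bar>v''\<bar>\<close> is at most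
  \<open>(c \<gamma> / \<gamma> + k) / \<gamma>\<close>; both tend to \<open>0\<close> uniformly on the line. As \<open>v 0\<close> is
  prescribed, the first bound also gives \<open>\<bar>v z - v 0\<bar> \<le> \<bar>z\<bar> / \<gamma>\<close>, hence the
  locally uniform convergence of the fronts themselves.
\<close>

section \<open>The slope as a function of the energy\<close>

text \<open>Along a front \<open>v\<close>, the quantity \<open>E = (1 / sqrt (1 - (\<gamma> v')\<^sup>2) -
  1) / \<gamma>\<close> plays the role of a kinetic energy. The function below is its inverse: it recovers
  \<open>v'\<close> from the energy level. With \<open>a = 1 / \<gamma>\<close> it is \<open>a sqrt (y (2 a
  + y)) / (a + y)\<close>.\<close>

definition slope :: "real \<Rightarrow> real \<Rightarrow> real" where
  "slope \<gamma> y = sqrt (1 - 1 / (1 + \<gamma> * y)\<^sup>2) / \<gamma>"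

lemma slope_zero [simp]: "slope \<gamma> 0 = 0"
  by (simp add: slope_def)

text \<open>All monotonicity properties in \<open>\<gamma>\<close> and \<open>y\<close> are read off either
  from the definition or from the following form.\<close>

lemma slope_eq_sqrt:
  assumes "\<gamma> > 0" "y \<ge> 0"
  shows "slope \<gamma> y = sqrt (y / \<gamma> * (1 / (1 + \<gamma> * y) + 1 / (1 + \<gamma> * y)\<^sup>2))"
proof -
  have p: "1 + \<gamma> * y > 0" using assms by (smt (verit) mult_nonneg_nonneg)
  have "y / \<gamma> * (1 / (1 + \<gamma> * y) + 1 / (1 + \<gamma> * y)\<^sup>2) = (1 - 1 / (1 + \<gamma> * y)\<^sup>2) / \<gamma>\<^sup>2"
    using p assms by (simp add: divide_simps) (simp add: power2_eq_square algebra_simps)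
  then show ?thesis using assms by (simp add: slope_def real_sqrt_divide)
qed

lemma slope_sq:
  assumes "\<gamma> > 0" "y \<ge> 0"
  shows "(\<gamma> * slope \<gamma> y)\<^sup>2 = 1 - 1 / (1 + \<gamma> * y)\<^sup>2"
proof -
  have "1 + \<gamma> * y \<ge> 1" using assms by simp
  then have "(1 + \<gamma> * y)\<^sup>2 \<ge> 1" by simp
  then have "1 - 1 / (1 + \<gamma> * y)\<^sup>2 \<ge> 0" by (simp add: divide_le_eq_1)
  then show ?thesis using assms by (simp add: slope_def)
qed

lemma slope_nonneg: "\<gamma> > 0 \<Longrightarrow> y \<ge> 0 \<Longrightarrow> slope \<gamma> y \<ge> 0"
  by (simp add: slope_eq_sqrt)

lemma slope_pos:
  assumes "\<gamma> > 0" "y > 0" shows "slope \<gamma> y > 0"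
proof -
  have "1 + \<gamma> * y > 1" using assms by simp
  then have "(1 + \<gamma> * y)\<^sup>2 > 1" by simp
  then show ?thesis using assms by (simp add: slope_def divide_less_eq_1)
qed

lemma slope_less:
  assumes "\<gamma> > 0" "y \<ge> 0" shows "\<gamma> * slope \<gamma> y < 1"
proof -
  have p: "1 + \<gamma> * y > 0" using assms by (smt (verit) mult_nonneg_nonneg)
  then have "(\<gamma> * slope \<gamma> y)\<^sup>2 < 1" using slope_sq[OF assms] by simp
  then show ?thesis by (simp add: power_less_one_iff abs_square_less_1)
qed

text \<open>The two monotonicity properties in \<open>\<gamma>\<close> that drive the theorem:
  \<open>\<gamma> * slope \<gamma> y\<close> is nondecreasing in \<open>\<gamma>\<close>, whereas
  \<open>slope \<gamma> y\<close> is nonincreasing in \<open>\<gamma>\<close>.\<close>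

lemma gamma_slope_mono:
  assumes "0 \<le> \<gamma>1 * y1" "\<gamma>1 * y1 \<le> \<gamma>2 * y2" "\<gamma>1 > 0" "\<gamma>2 > 0"
  shows "\<gamma>1 * slope \<gamma>1 y1 \<le> \<gamma>2 * slope \<gamma>2 y2"
  using assms by (simp add: slope_def frac_le power_mono)

lemma slope_mono:
  assumes "\<gamma> > 0" "0 \<le> y1" "y1 \<le> y2"
  shows "slope \<gamma> y1 \<le> slope \<gamma> y2"
  using gamma_slope_mono[of \<gamma> y1 \<gamma> y2] assms by simp

lemma slope_antimono_gamma:
  assumes "0 < \<gamma>1" "\<gamma>1 \<le> \<gamma>2" "y \<ge> 0"
  shows "slope \<gamma>2 y \<le> slope \<gamma>1 y"
proof -
  have "1 + \<gamma>1 * y > 0" "1 + \<gamma>1 * y \<le> 1 + \<gamma>2 * y"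
    using assms by (auto intro: mult_right_mono add_pos_nonneg)
  then show ?thesis using assms
    by (simp add: slope_eq_sqrt) (intro mult_mono frac_le add_mono power_mono; simp)
qed

lemma slope_le_sqrt:
  assumes "\<gamma> > 0" "y \<ge> 0"
  shows "slope \<gamma> y \<le> sqrt (2 / \<gamma>) * sqrt y"
proof -
  have p: "1 + \<gamma> * y \<ge> 1" using assms by simp
  then have "1 / (1 + \<gamma> * y) + 1 / (1 + \<gamma> * y)\<^sup>2 \<le> 1 + 1"
    by (intro add_mono) auto
  then have "y / \<gamma> * (1 / (1 + \<gamma> * y) + 1 / (1 + \<gamma> * y)\<^sup>2) \<le> y / \<gamma> * (1 + 1)"
    using assms by (intro mult_left_mono) auto
  then show ?thesis
    unfolding slope_eq_sqrt[OF assms] real_sqrt_mult[symmetric]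
    by (intro real_sqrt_le_mono) (simp add: field_simps)
qed

lemma slope_div_sqrt_antimono:
  assumes "\<gamma> > 0" "0 < y1" "y1 \<le> y2"
  shows "slope \<gamma> y2 / sqrt y2 \<le> slope \<gamma> y1 / sqrt y1"
proof -
  have eq: "slope \<gamma> y / sqrt y = sqrt ((1 / (1 + \<gamma> * y) + 1 / (1 + \<gamma> * y)\<^sup>2) / \<gamma>)" if "y > 0" for y
    using that assms(1) by (simp add: slope_eq_sqrt real_sqrt_divide[symmetric] del: real_sqrt_divide)

  have "1 + \<gamma> * y1 > 0" "1 + \<gamma> * y1 \<le> 1 + \<gamma> * y2"
    using assms by (auto intro: mult_left_mono add_pos_nonneg)
  then show ?thesis using assms
    by (simp only: eq less_le_trans[OF assms(2,3)])
       (intro real_sqrt_le_mono divide_right_mono add_mono frac_le power_mono; simp)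
qed

text \<open>The slope behaves like a square root at \<open>0\<close>, so it is only Hoelder continuous of
  exponent \<open>1/2\<close> there; away from \<open>0\<close> it is Lipschitz.\<close>

lemma slope_dist_le:
  assumes "\<gamma> > 0" "0 \<le> y1" "y1 \<le> y2"
  shows "slope \<gamma> y2 - slope \<gamma> y1 \<le> sqrt (2 / \<gamma>) * sqrt (y2 - y1)"
proof -
  let ?p = "1 + \<gamma> * y1" let ?q = "1 + \<gamma> * y2"
  have p: "?p \<ge> 1" "?q \<ge> ?p" using assms by (auto intro: mult_left_mono)
  have a: "slope \<gamma> y1 \<ge> 0" "slope \<gamma> y2 \<ge> slope \<gamma> y1"
    using assms by (auto intro: slope_nonneg slope_mono)
  have "1 / ?p\<^sup>2 - 1 / ?q\<^sup>2 = (1 / ?p - 1 / ?q) * (1 / ?p + 1 / ?q)"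
    by (simp add: power2_eq_square algebra_simps)
  also have "\<dots> \<le> (\<gamma> * (y2 - y1)) * 2"
  proof (intro mult_mono)
    have "1 / ?p - 1 / ?q = (?q - ?p) / (?p * ?q)" using p by (simp add: field_simps)
    also have "\<dots> \<le> (?q - ?p) / 1"
      using p by (intro divide_left_mono) (auto simp: mult_ge1_I intro: mult_pos_pos)
    finally show "1 / ?p - 1 / ?q \<le> \<gamma> * (y2 - y1)" by (simp add: algebra_simps)
    have "1 / ?p \<le> 1" "1 / ?q \<le> 1" using p by auto
    then show "1 / ?p + 1 / ?q \<le> 2" by simp
  qed (use p assms in auto)
  finally have 1: "1 / ?p\<^sup>2 - 1 / ?q\<^sup>2 \<le> 2 * \<gamma> * (y2 - y1)" by simp
  have "(\<gamma> * (slope \<gamma> y2 - slope \<gamma> y1))\<^sup>2 \<le> (\<gamma> * slope \<gamma> y2)\<^sup>2 - (\<gamma> * slope \<gamma> y1)\<^sup>2"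
  proof -
    have "(slope \<gamma> y2 - slope \<gamma> y1) * (slope \<gamma> y2 - slope \<gamma> y1) \<le>
       (slope \<gamma> y2 - slope \<gamma> y1) * (slope \<gamma> y2 + slope \<gamma> y1)"
      using a by (intro mult_left_mono) auto
    then have "\<gamma>\<^sup>2 * ((slope \<gamma> y2 - slope \<gamma> y1) * (slope \<gamma> y2 - slope \<gamma> y1)) \<le>
       \<gamma>\<^sup>2 * ((slope \<gamma> y2 - slope \<gamma> y1) * (slope \<gamma> y2 + slope \<gamma> y1))"
      by (rule mult_left_mono) auto
    then show ?thesis by (simp add: power2_eq_square algebra_simps)
  qed
  also have "\<dots> \<le> 2 * \<gamma> * (y2 - y1)" using 1 assms by (simp add: slope_sq)
  finally have "\<gamma> * (\<gamma> * (slope \<gamma> y2 - slope \<gamma> y1)\<^sup>2) \<le> \<gamma> * (2 * (y2 - y1))"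
    by (simp only: power2_eq_square mult_ac)
  then have "\<gamma> * (slope \<gamma> y2 - slope \<gamma> y1)\<^sup>2 \<le> 2 * (y2 - y1)"
    using assms(1) by (simp only: mult_le_cancel_left_pos)
  then have "(slope \<gamma> y2 - slope \<gamma> y1)\<^sup>2 \<le> 2 / \<gamma> * (y2 - y1)"
    using assms(1) by (simp add: pos_le_divide_eq mult.commute)
  then show ?thesis
    unfolding real_sqrt_mult[symmetric] by (rule real_le_rsqrt)
qed

lemma slope_has_derivative:
  assumes "\<gamma> > 0" "y > 0"
  shows "(slope \<gamma> has_real_derivative 1 / (\<gamma> * (1 + \<gamma> * y) ^ 3 * slope \<gamma> y)) (at y)"
proof -
  have p: "1 + \<gamma> * y > 1" using assms by simp
  then have "(1 + \<gamma> * y)\<^sup>2 > 1" by simp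
  then have q: "1 - 1 / (1 + \<gamma> * y)\<^sup>2 > 0" by (simp add: divide_less_eq_1)
  let ?s = "sqrt (1 - 1 / (1 + \<gamma> * y)\<^sup>2)"
  have "((\<lambda>p. 1 - 1 / p\<^sup>2) has_real_derivative 2 / p ^ 3) (at p)" if "p > 1" for p :: real
    using that by (auto intro!: derivative_eq_intros simp: power2_eq_square power3_eq_cube)
  from DERIV_chain2[where f="\<lambda>p. 1 - 1 / p\<^sup>2" and g="\<lambda>y. 1 + \<gamma> * y", OF this[OF p]]
  have "((\<lambda>y. 1 - 1 / (1 + \<gamma> * y)\<^sup>2) has_real_derivative 2 / (1 + \<gamma> * y) ^ 3 * \<gamma>) (at y)"
    by (rule meta_mp) (auto intro!: derivative_eq_intros)
  from DERIV_cdivide[OF DERIV_chain2[where f=sqrt and g="\<lambda>y. 1 - 1 / (1 + \<gamma> * y)\<^sup>2",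
      OF DERIV_real_sqrt[OF q] this], of \<gamma>]
  have "((\<lambda>y. sqrt (1 - 1 / (1 + \<gamma> * y)\<^sup>2) / \<gamma>) has_real_derivative
      inverse ?s / 2 * (2 / (1 + \<gamma> * y) ^ 3 * \<gamma>) / \<gamma>) (at y)" .
  also have "inverse ?s / 2 * (2 / (1 + \<gamma> * y) ^ 3 * \<gamma>) / \<gamma> = 1 / (\<gamma> * (1 + \<gamma> * y) ^ 3 * slope \<gamma> y)"
    using assms by (simp add: slope_def divide_simps)
  finally show ?thesis unfolding slope_def[abs_def] by simp
qed

lemma slope_lipschitz:
  assumes "\<gamma> > 0" "\<epsilon> > 0" "y1 \<ge> \<epsilon>" "y2 \<ge> \<epsilon>"
  shows "\<bar>slope \<gamma> y1 - slope \<gamma> y2\<bar> \<le> 1 / (\<gamma> * slope \<gamma> \<epsilon>) * \<bar>y1 - y2\<bar>"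
proof -
  have "norm (slope \<gamma> y1 - slope \<gamma> y2) \<le> 1 / (\<gamma> * slope \<gamma> \<epsilon>) * norm (y1 - y2)"
  proof (rule field_differentiable_bound[of "{\<epsilon>..}"])
    fix y assume "y \<in> {\<epsilon>..}"
    then have y: "y \<ge> \<epsilon>" "y > 0" using assms by auto
    show "(slope \<gamma> has_real_derivative 1 / (\<gamma> * (1 + \<gamma> * y) ^ 3 * slope \<gamma> y)) (at y within {\<epsilon>..})"
      using slope_has_derivative[OF assms(1) y(2)] by (rule DERIV_subset) simp
    have "\<gamma> * 1 * slope \<gamma> \<epsilon> \<le> \<gamma> * (1 + \<gamma> * y) ^ 3 * slope \<gamma> y"
      using assms y slope_mono[of \<gamma> \<epsilon> y] slope_pos[of \<gamma> \<epsilon>]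
      by (intro mult_mono one_le_power) auto
    then show "norm (1 / (\<gamma> * (1 + \<gamma> * y) ^ 3 * slope \<gamma> y)) \<le> 1 / (\<gamma> * slope \<gamma> \<epsilon>)"
      using assms y slope_pos[of \<gamma> \<epsilon>] slope_pos[of \<gamma> y] by (simp add: frac_le)
  qed (use assms in auto)
  then show ?thesis by simp
qed

section \<open>Comparison and existence for scalar differential equations\<close>

text \<open>A function that starts at a nonpositive value and does not increase while it is positive stays
  nonpositive. Nothing is required of it where it is nonpositive, which is what makes the lemma suitable for
  comparing solutions of differential equations.\<close>

lemma nonpos_if_nonincreasing_where_pos:
  fixes e :: "real \<Rightarrow> real"
  assumes "continuous_on {a..b} e" "e a \<le> 0"
    and "\<And>x. a < x \<Longrightarrow> x < b \<Longrightarrow> e x > 0 \<Longrightarrow> \<exists>D\<le>0. (e has_real_derivative D) (at x)"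
    and "x \<in> {a..b}"
  shows "e x \<le> 0"
proof (rule ccontr)
  assume "\<not> e x \<le> 0"
  \<comment> \<open>The supremum of \<open>S\<close> is the last point before \<open>x\<close> at which \<open>e\<close> is nonpositive.\<close>
  define S where "S = {a..x} \<inter> e -` {..0}"
  have cont: "continuous_on {a..x} e" using assms(1,4) by (auto intro: continuous_on_subset)
  have "closed S" unfolding S_def by (intro continuous_closed_preimage cont) auto
  moreover have "a \<in> S" using assms by (auto simp: S_def)
  moreover have bdd: "bdd_above S" by (auto simp: S_def intro!: bdd_aboveI[of _ x])
  ultimately have s: "Sup S \<in> S" using closed_contains_Sup by blast
  define s where "s = Sup S"
  have s: "s \<in> {a..x}" "e s \<le> 0" using s by (auto simp: S_def s_def)
  have pos: "e t > 0" if "s < t" "t \<le> x" for t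
  proof (rule ccontr)
    assume "\<not> e t > 0"
    then have "t \<in> S" using that s by (auto simp: S_def)
    then have "t \<le> s" using bdd by (auto simp: s_def intro: cSup_upper)
    then show False using that by simp
  qed
  have "e x \<le> e s"
  proof (rule DERIV_nonpos_imp_decreasing_open[of s x e])
    show "continuous_on {s..x} e" using cont s by (auto intro: continuous_on_subset)
    show "\<exists>y. (e has_real_derivative y) (at t) \<and> y \<le> 0" if "s < t" "t < x" for t
      using assms(3)[of t] pos[of t] that s assms(4) by auto
  qed (use s in auto)
  then show False using s \<open>\<not> e x \<le> 0\<close> by simp
qed

lemma nonpos_if_nondecreasing_where_pos:
  fixes e :: "real \<Rightarrow> real"
  assumes "continuous_on {a..b} e" "e b \<le> 0"
    and "\<And>x. a < x \<Longrightarrow> x < b \<Longrightarrow> e x > 0 \<Longrightarrow> \<exists>D\<ge>0. (e has_real_derivative D) (at x)"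
    and "x \<in> {a..b}"
  shows "e x \<le> 0"
proof -
  have "e (- (-x)) \<le> 0"
  proof (rule nonpos_if_nonincreasing_where_pos[of "-b" "-a" "\<lambda>x. e (- x)" "-x"])
    show "continuous_on {- b..- a} (\<lambda>x. e (- x))"
      by (rule continuous_on_compose2[OF assms(1)]) (auto intro: continuous_intros)
    fix x assume x: "- b < x" "x < - a" "0 < e (- x)"
    then obtain D where "D \<ge> 0" "(e has_real_derivative D) (at (- x))" using assms(3)[of "-x"] by auto
    then show "\<exists>D\<le>0. ((\<lambda>x. e (- x)) has_real_derivative D) (at x)"
      by (intro exI[of _ "- D"]) (auto simp: DERIV_mirror)
  qed (use assms in auto)
  then show ?thesis by simp
qed

text \<open>Banach's fixed point theorem, applied to \<open>z t = exp (- 2 M t) * u t\<close>: the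
  exponential weight makes the integral operator a contraction on the whole of \<open>[0, 1]\<close>, with
  constant \<open>1/2\<close>. Functions on \<open>[0, 1]\<close> are extended to bounded continuous
  functions on the line by clamping the argument.\<close>

lemma picard_unit_interval:
  fixes q G :: "real \<Rightarrow> real"
  assumes q: "continuous_on {0..1} q" and L: "L-lipschitz_on UNIV G"
  shows "\<exists>u. u 0 = 0 \<and> (\<forall>t\<in>{0..1}. (u has_real_derivative q t - G (u t)) (at t within {0..1}))"
proof -
  \<comment> \<open>A positive Lipschitz constant, also when \<open>L = 0\<close>.\<close>
  define M where "M = L + 1"
  have M: "M > 0" using lipschitz_on_nonneg[OF L] by (simp add: M_def)
  have G: "\<bar>G x - G y\<bar> \<le> M * \<bar>x - y\<bar>" for x y
  proof -
    have "\<bar>G x - G y\<bar> \<le> L * \<bar>x - y\<bar>" using lipschitz_onD[OF L, of x y] by (simp add: dist_real_def)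
    also have "\<dots> \<le> M * \<bar>x - y\<bar>" by (simp add: M_def mult_right_mono)
    finally show ?thesis .
  qed
  have Gc: "continuous_on UNIV G" using L by (rule lipschitz_on_continuous_on)
  define R where "R z s = q s - G (exp (2 * M * s) * apply_bcontfun z s)" for z s
  have Rc: "continuous_on {0..1} (R z)" for z
    unfolding R_def by (intro continuous_intros q continuous_on_compose2[OF Gc]) auto
  define A where "A z t = exp (- 2 * M * t) * integral {0..t} (R z)" for z t
  have Ac: "continuous_on {0..1} (A z)" for z
    unfolding A_def
    by (intro continuous_intros indefinite_integral_continuous_1 integrable_continuous_real Rc)
  have "\<exists>h::real \<Rightarrow>\<^sub>C real. \<forall>t. apply_bcontfun h t = A z (clamp 0 1 t)" for z
    using Ac[of z] continuous_on_cbox_bcontfunE[of 0 1 "A z"] unfolding cbox_interval by metis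
  then obtain T :: "(real \<Rightarrow>\<^sub>C real) \<Rightarrow> (real \<Rightarrow>\<^sub>C real)"
    where T: "apply_bcontfun (T z) t = A z (clamp 0 1 t)" for z t by metis
  have clamp01: "clamp 0 1 t \<in> {0..1::real}" for t
    using clamp_in_interval[of 0 1 t] unfolding cbox_interval by simp
  have A_dist: "\<bar>A z1 t - A z2 t\<bar> \<le> 1/2 * dist z1 z2" if t: "t \<in> {0..1}" for z1 z2 t
  proof -
    let ?D = "dist z1 z2"
    have int: "R z integrable_on {0..t}" for z
      using t by (intro integrable_continuous_real continuous_on_subset[OF Rc]) auto
    have exp_int: "((\<lambda>s. M * exp (2 * M * s) * ?D) has_integral
        (exp (2 * M * t) * ?D / 2 - exp (2 * M * 0) * ?D / 2)) {0..t}"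
      using t M by (intro fundamental_theorem_of_calculus)
        (auto intro!: derivative_eq_intros simp flip: has_real_derivative_iff_has_vector_derivative)
    have "norm (integral {0..t} (\<lambda>s. R z1 s - R z2 s)) \<le> integral {0..t} (\<lambda>s. M * exp (2 * M * s) * ?D)"
    proof (rule integral_norm_bound_integral)
      fix s
      have "norm (R z1 s - R z2 s) \<le> M * \<bar>exp (2 * M * s) * z2 s - exp (2 * M * s) * z1 s\<bar>"
        unfolding R_def using G by simp
      also have "exp (2 * M * s) * z2 s - exp (2 * M * s) * z1 s = exp (2 * M * s) * (z2 s - z1 s)"
        by (simp add: algebra_simps)
      also have "M * \<bar>\<dots>\<bar> \<le> M * (exp (2 * M * s) * ?D)"
        using M dist_bounded[of z1 s z2] by (auto simp: abs_mult dist_real_def)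
      finally show "norm (R z1 s - R z2 s) \<le> M * exp (2 * M * s) * ?D" by (simp add: mult.assoc)
    qed (use int exp_int in \<open>auto intro: integrable_diff\<close>)
    also have "\<dots> = exp (2 * M * t) * ?D / 2 - exp (2 * M * 0) * ?D / 2"
      by (rule integral_unique[OF exp_int])
    also have "\<dots> \<le> exp (2 * M * t) * ?D / 2" by simp
    finally have I: "\<bar>integral {0..t} (R z1) - integral {0..t} (R z2)\<bar> \<le> exp (2 * M * t) * ?D / 2"
      using int by (simp add: integral_diff)
    have "\<bar>A z1 t - A z2 t\<bar> = exp (- 2 * M * t) * \<bar>integral {0..t} (R z1) - integral {0..t} (R z2)\<bar>"
      by (simp add: A_def abs_mult flip: right_diff_distrib)
    also have "\<dots> \<le> exp (- 2 * M * t) * (exp (2 * M * t) * ?D / 2)"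
      using I by (intro mult_left_mono) auto
    also have "\<dots> = 1/2 * ?D" by (simp add: exp_minus field_simps)
    finally show ?thesis .
  qed
  have "dist (T z1) (T z2) \<le> 1/2 * dist z1 z2" for z1 z2
    by (rule dist_bound) (use A_dist clamp01 in \<open>auto simp: T dist_real_def\<close>)
  then obtain z where z: "T z = z"
    using banach_fix_type[of "1/2" T] by auto
  define u where "u t = integral {0..t} (R z)" for t
  have u: "u t = exp (2 * M * t) * apply_bcontfun z t" if "t \<in> {0..1}" for t
  proof -
    have "apply_bcontfun z t = A z t"
      using T[of z t] that by (simp add: z clamp_cancel_cbox)
    then show ?thesis by (simp add: A_def u_def exp_minus)
  qed
  have "(u has_real_derivative q t - G (u t)) (at t within {0..1})" if "t \<in> {0..1}" for t
    using integral_has_real_derivative[OF Rc that, of z] u[OF that]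
    unfolding u_def[abs_def] R_def by simp
  moreover have "u 0 = 0" by (simp add: u_def)
  ultimately show ?thesis by blast
qed

text \<open>For nondecreasing \<open>G\<close> the Lipschitz condition can be dispensed with. If
  \<open>H\<close> and \<open>H'\<close> are nondecreasing and differ by at most \<open>\<delta>\<close>,
  then solutions of \<open>u' = q - H u\<close> and \<open>u' = q - H' u\<close> with the same initial value
  differ by at most \<open>\<delta>\<close> on \<open>[0, 1]\<close>, whatever the Lipschitz constants are;
  hence the solutions of the approximating problems converge uniformly.\<close>

lemma monotone_ode_unit_interval:
  fixes q G :: "real \<Rightarrow> real"
  assumes q: "continuous_on {0..1} q" and Gc: "uniformly_continuous_on UNIV G"
    and H: "\<And>e. e > 0 \<Longrightarrow> \<exists>H L. mono H \<and> L-lipschitz_on UNIV H \<and> (\<forall>x. \<bar>H x - G x\<bar> \<le> e)"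
  shows "\<exists>u. u 0 = 0 \<and> (\<forall>t\<in>{0..1}. (u has_real_derivative q t - G (u t)) (at t within {0..1}))"
proof -
  have "\<forall>n. \<exists>H u. mono H \<and> (\<forall>x. \<bar>H x - G x\<bar> \<le> inverse (Suc n)) \<and> u 0 = 0 \<and>
      (\<forall>t\<in>{0..1}. (u has_real_derivative q t - H (u t)) (at t within {0..1}))"
  proof
    fix n :: nat
    obtain H L where "mono H" "L-lipschitz_on UNIV H" "\<forall>x. \<bar>H x - G x\<bar> \<le> inverse (Suc n)"
      using H[of "inverse (Suc n)"] by auto
    with picard_unit_interval[OF q this(2)] show "\<exists>H u. mono H \<and> (\<forall>x. \<bar>H x - G x\<bar> \<le> inverse (Suc n)) \<and> u 0 = 0 \<and>
      (\<forall>t\<in>{0..1}. (u has_real_derivative q t - H (u t)) (at t within {0..1}))" by blast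
  qed
  then obtain H u where mono: "\<And>n. mono (H n)"
    and HG: "\<And>n x. \<bar>H n x - G x\<bar> \<le> inverse (real (Suc n))" and u0: "\<And>n. u n 0 = 0"
    and du: "\<And>n t. t \<in> {0..1} \<Longrightarrow> (u n has_real_derivative q t - H n (u n t)) (at t within {0..1})"
    by (metis (no_types, lifting))
  have uc: "continuous_on {0..1} (u n)" for n
    using du by (rule DERIV_continuous_on)
  have du': "(u n has_real_derivative q t - H n (u n t)) (at t)" if "0 < t" "t < 1" for n t
    using du[of t n] that by (simp add: at_within_Icc_at)
  have close: "u n t - u m t \<le> (inverse (Suc n) + inverse (Suc m))" if t: "t \<in> {0..1}" for n m t
  proof -
    define \<delta> where "\<delta> = inverse (real (Suc n)) + inverse (real (Suc m))"
    have d: "\<delta> \<ge> 0" by (simp add: \<delta>_def)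
    have "u n t - u m t - \<delta> * t \<le> 0"
    proof (rule nonpos_if_nonincreasing_where_pos[of 0 1 _ t])
      show "continuous_on {0..1} (\<lambda>t. u n t - u m t - \<delta> * t)" by (intro continuous_intros uc)
      fix x :: real assume x: "0 < x" "x < 1" "0 < u n x - u m x - \<delta> * x"
      have "\<delta> * x \<ge> 0" using x d by (intro mult_nonneg_nonneg) auto
      then have "u n x \<ge> u m x" using x by linarith
      then have "H n (u n x) \<ge> H n (u m x)" using mono[of n] by (auto dest: monoD)
      then have "(q x - H n (u n x)) - (q x - H m (u m x)) - \<delta> \<le> 0"
        using HG[of n "u m x"] HG[of m "u m x"] unfolding \<delta>_def by linarith
      moreover have "((\<lambda>t. u n t - u m t - \<delta> * t) has_real_derivative
          (q x - H n (u n x)) - (q x - H m (u m x)) - \<delta>) (at x)"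
        by (rule derivative_eq_intros du' x refl | simp)+
      ultimately show "\<exists>D\<le>0. ((\<lambda>t. u n t - u m t - \<delta> * t) has_real_derivative D) (at x)" by blast
    qed (use t u0 in auto)
    moreover have "\<delta> * t \<le> \<delta> * 1" using t d by (intro mult_left_mono) auto
    ultimately have "u n t - u m t \<le> \<delta>" by linarith
    then show ?thesis by (simp add: \<delta>_def)
  qed
  have inv0: "(\<lambda>n. inverse (real (Suc n))) \<longlonglongrightarrow> 0" by (rule LIMSEQ_inverse_real_of_nat)
  have "uniformly_Cauchy_on {0..1} u"
    unfolding uniformly_Cauchy_on_def
  proof (intro allI impI)
    fix e :: real assume "e > 0"
    then have "\<forall>\<^sub>F n in sequentially. inverse (real (Suc n)) < e/2"
      by (intro order_tendstoD(2)[OF inv0]) auto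
    then obtain N where N: "\<And>n. n \<ge> N \<Longrightarrow> inverse (real (Suc n)) < e/2"
      by (auto simp: eventually_sequentially)
    show "\<exists>M. \<forall>x\<in>{0..1}. \<forall>m\<ge>M. \<forall>n\<ge>M. dist (u m x) (u n x) < e"
    proof (intro exI[of _ N] ballI allI impI)
      fix x m n assume "x \<in> {0..1::real}" "m \<ge> N" "n \<ge> N"
      then show "dist (u m x) (u n x) < e"
        using close[of x m n] close[of x n m] N[of m] N[of n] by (simp add: dist_real_def)
    qed
  qed
  then obtain w where w: "uniform_limit {0..1} u w sequentially"
    by (auto simp: uniformly_convergent_on_def dest!: Cauchy_uniformly_convergent)
  have Hlim: "uniform_limit {0..1} (\<lambda>n t. q t - H n (u n t)) (\<lambda>t. q t - G (w t)) sequentially"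
  proof -
    have 1: "uniform_limit {0..1} (\<lambda>n t. G (u n t)) (\<lambda>t. G (w t)) sequentially"
      using uniform_limit_compose[OF w Gc] by (simp add: o_def)
    have 2: "uniform_limit {0..1} (\<lambda>n t. H n (u n t) - G (u n t)) (\<lambda>t. 0) sequentially"
    proof (rule uniform_limitI)
      fix e :: real assume "e > 0"
      from order_tendstoD(2)[OF inv0 this]
      show "\<forall>\<^sub>F n in sequentially. \<forall>x\<in>{0..1}. dist (H n (u n x) - G (u n x)) 0 < e"
        by eventually_elim (use HG in \<open>auto simp: dist_real_def simp del: of_nat_Suc intro: le_less_trans\<close>)
    qed
    from uniform_limit_add[OF 1 2] have "uniform_limit {0..1} (\<lambda>n t. H n (u n t)) (\<lambda>t. G (w t)) sequentially" by simp
    from uniform_limit_minus[OF uniform_limit_const this] show ?thesis .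
  qed
  have "\<exists>g. \<forall>x\<in>{0..1}. (\<lambda>n. u n x) \<longlonglongrightarrow> g x \<and>
      (g has_derivative (*) (q x - G (w x))) (at x within {0..1})"
  proof (rule has_derivative_sequence)
    show "(u n has_derivative (*) (q x - H n (u n x))) (at x within {0..1})" if "x \<in> {0..1}" for n x
      using du[OF that] by (simp add: has_field_derivative_def)
    show "\<forall>\<^sub>F n in sequentially. \<forall>x\<in>{0..1}. \<forall>h. norm ((q x - H n (u n x)) * h - (q x - G (w x)) * h) \<le> e * norm h"
      if "e > 0" for e
      using uniform_limitD[OF Hlim that]
    proof eventually_elim
      case (elim n)
      show ?case
      proof (intro ballI allI)
        fix x h :: real assume "x \<in> {0..1}"
        then have "\<bar>(q x - H n (u n x)) - (q x - G (w x))\<bar> \<le> e" using elim by (force simp: dist_real_def)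
        then show "norm ((q x - H n (u n x)) * h - (q x - G (w x)) * h) \<le> e * norm h"
          by (simp add: abs_mult mult_right_mono flip: left_diff_distrib del: diff_diff_eq2 add_diff_cancel_left)
      qed
    qed
    show "(\<lambda>n. u n 0) \<longlonglongrightarrow> 0" using u0 by simp
  qed auto
  then obtain g where g: "\<And>x. x \<in> {0..1} \<Longrightarrow> (\<lambda>n. u n x) \<longlonglongrightarrow> g x"
    "\<And>x. x \<in> {0..1} \<Longrightarrow> (g has_derivative (*) (q x - G (w x))) (at x within {0..1})" by blast
  have gw: "g x = w x" if "x \<in> {0..1}" for x
    using g(1)[OF that] tendsto_uniform_limitI[OF w that] LIMSEQ_unique by blast
  have "g 0 = 0" using g(1)[of 0] u0 by (simp add: LIMSEQ_const_iff)
  then show ?thesis using g(2) gw by (auto simp: has_field_derivative_def intro!: exI[of _ g])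
qed

section \<open>Energy of a front\<close>

text \<open>The kinetic energy of a front whose derivative is \<open>p\<close>; it is meaningful for
  \<open>\<gamma> \<bar>p\<bar> < 1\<close>.\<close>

definition energy :: "real \<Rightarrow> real \<Rightarrow> real" where
  "energy \<gamma> p = (1 / sqrt (1 - \<gamma>\<^sup>2 * p\<^sup>2) - 1) / \<gamma>"

lemma subcritical_root_pos:
  assumes "\<gamma> > 0" "\<gamma> * \<bar>p\<bar> < 1"
  shows "sqrt (1 - \<gamma>\<^sup>2 * p\<^sup>2) > 0"
    and "(sqrt (1 - \<gamma>\<^sup>2 * p\<^sup>2))\<^sup>2 = 1 - \<gamma>\<^sup>2 * p\<^sup>2"
    and "sqrt (1 - \<gamma>\<^sup>2 * p\<^sup>2) \<le> 1"
proof -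
  have "(\<gamma> * \<bar>p\<bar>)\<^sup>2 < 1" using assms by (simp add: power_less_one_iff abs_mult abs_square_less_1)
  then have "\<gamma>\<^sup>2 * p\<^sup>2 < 1" by (simp add: power_mult_distrib)
  then show "sqrt (1 - \<gamma>\<^sup>2 * p\<^sup>2) > 0" "(sqrt (1 - \<gamma>\<^sup>2 * p\<^sup>2))\<^sup>2 = 1 - \<gamma>\<^sup>2 * p\<^sup>2" by auto
  show "sqrt (1 - \<gamma>\<^sup>2 * p\<^sup>2) \<le> 1" by simp
qed

lemma energy_zero [simp]: "energy \<gamma> 0 = 0"
  by (simp add: energy_def)

lemma energy_nonneg:
  assumes "\<gamma> > 0" "\<gamma> * \<bar>p\<bar> < 1"
  shows "energy \<gamma> p \<ge> 0"
  using subcritical_root_pos[OF assms] assms(1) by (simp add: energy_def)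

lemma slope_energy:
  assumes "\<gamma> > 0" "\<gamma> * \<bar>p\<bar> < 1"
  shows "slope \<gamma> (energy \<gamma> p) = \<bar>p\<bar>"
proof -
  note s = subcritical_root_pos[OF assms]
  have "1 + \<gamma> * energy \<gamma> p = 1 / sqrt (1 - \<gamma>\<^sup>2 * p\<^sup>2)"
    using assms(1) by (simp add: energy_def)
  then have "1 - 1 / (1 + \<gamma> * energy \<gamma> p)\<^sup>2 = (\<gamma> * p)\<^sup>2"
    using s(2) by (simp add: power_divide power_mult_distrib)
  then show ?thesis using assms(1) by (simp add: slope_def abs_mult)
qed

lemma flux_has_derivative:
  assumes "\<gamma> > 0" "\<gamma> * \<bar>p\<bar> < 1"
  shows "((\<lambda>p. p / sqrt (1 - \<gamma>\<^sup>2 * p\<^sup>2)) has_real_derivative 1 / sqrt (1 - \<gamma>\<^sup>2 * p\<^sup>2) ^ 3) (at p)"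
proof -
  note s = subcritical_root_pos[OF assms]
  let ?s = "sqrt (1 - \<gamma>\<^sup>2 * p\<^sup>2)"
  have q: "1 - \<gamma>\<^sup>2 * p\<^sup>2 > 0" using s(1) by simp
  have "((\<lambda>p. p / sqrt (1 - \<gamma>\<^sup>2 * p\<^sup>2)) has_real_derivative
      (?s - p * (- (\<gamma>\<^sup>2 * (2 * p)) * (inverse ?s / 2))) / (?s * ?s)) (at p)"
    using q s(1) by (auto intro!: derivative_eq_intros)
  also have "(?s - p * (- (\<gamma>\<^sup>2 * (2 * p)) * (inverse ?s / 2))) / (?s * ?s) = (?s\<^sup>2 + \<gamma>\<^sup>2 * p\<^sup>2) / ?s ^ 3"
  proof -
    have "(r - p * (- (\<gamma>\<^sup>2 * (2 * p)) * (inverse r / 2))) / (r * r) = (r\<^sup>2 + \<gamma>\<^sup>2 * p\<^sup>2) / r ^ 3" if "r > 0" for r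
      using that by (simp add: field_simps power2_eq_square power3_eq_cube)
    then show ?thesis using s(1) .
  qed
  finally show ?thesis using s(2) by simp
qed

lemma energy_has_derivative:
  assumes "\<gamma> > 0" "\<gamma> * \<bar>p\<bar> < 1"
  shows "(energy \<gamma> has_real_derivative \<gamma> * p / sqrt (1 - \<gamma>\<^sup>2 * p\<^sup>2) ^ 3) (at p)"
proof -
  note s = subcritical_root_pos[OF assms]
  let ?s = "sqrt (1 - \<gamma>\<^sup>2 * p\<^sup>2)"
  have q: "1 - \<gamma>\<^sup>2 * p\<^sup>2 > 0" using s(1) by simp
  have "((\<lambda>p. (1 / sqrt (1 - \<gamma>\<^sup>2 * p\<^sup>2) - 1) / \<gamma>) has_real_derivative
      (- (- (\<gamma>\<^sup>2 * (2 * p)) * (inverse ?s / 2))) / (?s * ?s) / \<gamma>) (at p)"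
    using q s(1) assms(1) by (auto intro!: derivative_eq_intros)
  also have "(- (- (\<gamma>\<^sup>2 * (2 * p)) * (inverse ?s / 2))) / (?s * ?s) / \<gamma> = \<gamma> * p / ?s ^ 3"
  proof -
    have "(- (- (\<gamma>\<^sup>2 * (2 * p)) * (inverse r / 2))) / (r * r) / \<gamma> = \<gamma> * p / r ^ 3" if "r > 0" for r
      using that assms(1) by (simp add: field_simps power2_eq_square power3_eq_cube)
    then show ?thesis using s(1) .
  qed
  finally show ?thesis by (simp add: energy_def[abs_def])
qed

text \<open>A common description of the three types of reaction terms: \<open>f\<close> is nonpositive up to
  a threshold \<open>\<alpha>\<close> and positive between \<open>\<alpha>\<close> and \<open>1\<close>.
  Type A corresponds to \<open>\<alpha> = 0\<close>. The linear bound concerns the equilibrium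
  \<open>1\<close>; the behaviour of profiles at \<open>0\<close> is governed by the square root growth of
  the slope.\<close>

locale reaction =
  fixes f :: "real \<Rightarrow> real" and \<alpha> k :: real
  assumes f_cont: "continuous_on {0..1} f"
    and threshold: "0 \<le> \<alpha>" "\<alpha> < 1"
    and f_nonpos: "\<And>u. 0 \<le> u \<Longrightarrow> u \<le> \<alpha> \<Longrightarrow> f u \<le> 0"
    and f_pos: "\<And>u. \<alpha> < u \<Longrightarrow> u < 1 \<Longrightarrow> f u > 0"
    and f_bound: "\<And>u. 0 \<le> u \<Longrightarrow> u \<le> 1 \<Longrightarrow> \<bar>f u\<bar> \<le> k * (1 - u)"
    and k_pos: "k > 0"
    and mass_nonneg: "integral {0..1} f \<ge> 0"
begin

text \<open>The primitive of \<open>f\<close> vanishing at \<open>0\<close>; \<open>potential 1\<close> is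
  the total mass of \<open>f\<close>.\<close>

definition potential :: "real \<Rightarrow> real" where
  "potential u = integral {0..u} f"

lemma potential_zero [simp]: "potential 0 = 0"
  by (simp add: potential_def)

lemma potential_has_derivative:
  "u \<in> {0..1} \<Longrightarrow> (potential has_real_derivative f u) (at u within {0..1})"
  unfolding potential_def[abs_def] using f_cont by (rule integral_has_real_derivative)

lemma continuous_on_potential: "continuous_on {0..1} potential"
  using potential_has_derivative by (rule DERIV_continuous_on)

lemma f_le_k: "u \<in> {0..1} \<Longrightarrow> \<bar>f u\<bar> \<le> k"
  proof -
  assume "u \<in> {0..1}"
  then have "\<bar>f u\<bar> \<le> k * (1 - u)" "k * (1 - u) \<le> k * 1"
    using f_bound[of u] k_pos by (auto intro!: mult_left_mono)
  then show ?thesis by simp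
qed

end

text \<open>A heteroclinic solution of the equation with parameter \<open>\<gamma>\<close> and speed
  \<open>c\<close>.\<close>

locale front = reaction +
  fixes \<gamma> c :: real and v :: "real \<Rightarrow> real"
  assumes gamma_pos: "\<gamma> > 0" and het: "heteroclinic f \<gamma> c v"
begin

lemma v_has_derivative: "(v has_real_derivative deriv v z) (at z)"
  using het by (simp add: heteroclinic_def C2_def DERIV_deriv_iff_real_differentiable)

lemma v'_has_derivative: "(deriv v has_real_derivative deriv (deriv v) z) (at z)"
  using het by (simp add: heteroclinic_def C2_def DERIV_deriv_iff_real_differentiable)

lemma v_range: "v z \<in> {0..1}" and subcritical: "\<gamma> * \<bar>deriv v z\<bar> < 1"
  and v_mono: "mono v" and v_at_bot: "(v \<longlongrightarrow> 0) at_bot" and v_at_top: "(v \<longlongrightarrow> 1) at_top"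
  using het by (simp_all add: heteroclinic_def)

lemma v'_nonneg: "deriv v z \<ge> 0"
proof -
  have "mono_on UNIV v" using v_mono by simp
  from mono_on_imp_deriv_nonneg[OF this v_has_derivative] show ?thesis by simp
qed

lemma v'_le: "deriv v z \<le> 1 / \<gamma>"
  using subcritical[of z] gamma_pos v'_nonneg[of z] by (simp add: field_simps)

text \<open>The equation with the flux differentiated: the flux \<open>v' / sqrt (1 - \<gamma>\<^sup>2
  v'\<^sup>2)\<close> has derivative \<open>v'' / (1 - \<gamma>\<^sup>2
  v'\<^sup>2)\<^bsup>3/2\<^esup>\<close>.\<close>

lemma v''_eq: "\<gamma> * (deriv (deriv v) z / sqrt (1 - \<gamma>\<^sup>2 * (deriv v z)\<^sup>2) ^ 3) = c * deriv v z - f (v z)"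
proof -
  have "deriv (\<lambda>x. deriv v x / sqrt (1 - \<gamma>\<^sup>2 * (deriv v x)\<^sup>2)) z
     = 1 / sqrt (1 - \<gamma>\<^sup>2 * (deriv v z)\<^sup>2) ^ 3 * deriv (deriv v) z"
    by (rule DERIV_imp_deriv DERIV_chain2 flux_has_derivative gamma_pos subcritical v'_has_derivative)+
  then show ?thesis using het by (auto simp: heteroclinic_def algebra_simps dest: spec[of _ z])
qed

lemma v''_bound: "\<bar>deriv (deriv v) z\<bar> \<le> (\<bar>c\<bar> / \<gamma> + k) / \<gamma>"
proof -
  note s = subcritical_root_pos[OF gamma_pos subcritical[of z]]
  let ?s = "sqrt (1 - \<gamma>\<^sup>2 * (deriv v z)\<^sup>2) ^ 3"
  have s3: "?s > 0" "?s \<le> 1" using s by (auto simp: power_le_one)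
  have "\<gamma> * deriv (deriv v) z = ?s * (c * deriv v z - f (v z))"
    using v''_eq[of z] s3(1) by (simp add: field_simps)
  then have "\<gamma> * \<bar>deriv (deriv v) z\<bar> = ?s * \<bar>c * deriv v z - f (v z)\<bar>"
    using gamma_pos s3(1) by (metis abs_mult abs_of_pos)
  also have "\<dots> \<le> 1 * (\<bar>c\<bar> / \<gamma> + k)"
  proof (intro mult_mono s3)
    have "\<bar>c * deriv v z - f (v z)\<bar> \<le> \<bar>c\<bar> * deriv v z + \<bar>f (v z)\<bar>"
      using v'_nonneg[of z] by (intro order.trans[OF abs_triangle_ineq4]) (simp add: abs_mult)
    also have "\<dots> \<le> \<bar>c\<bar> * (1 / \<gamma>) + k"
      by (intro add_mono mult_left_mono v'_le f_le_k v_range) auto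
    finally show "\<bar>c * deriv v z - f (v z)\<bar> \<le> \<bar>c\<bar> / \<gamma> + k" by simp
  qed auto
  finally show ?thesis using gamma_pos by (simp add: field_simps)
qed

text \<open>The kinetic energy along the front.\<close>

definition E :: "real \<Rightarrow> real" where "E z = energy \<gamma> (deriv v z)"

lemma E_nonneg: "E z \<ge> 0"
  unfolding E_def by (rule energy_nonneg[OF gamma_pos subcritical])

lemma slope_E: "slope \<gamma> (E z) = deriv v z"
  unfolding E_def using slope_energy[OF gamma_pos subcritical[of z]] v'_nonneg[of z] by simp

lemma E_has_derivative: "(E has_real_derivative deriv v z * (c * deriv v z - f (v z))) (at z)"
proof -
  have "((\<lambda>z. energy \<gamma> (deriv v z)) has_real_derivative
      \<gamma> * deriv v z / sqrt (1 - \<gamma>\<^sup>2 * (deriv v z)\<^sup>2) ^ 3 * deriv (deriv v) z) (at z)"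
    by (rule DERIV_chain2 energy_has_derivative gamma_pos subcritical v'_has_derivative)+
  also have "\<gamma> * deriv v z / sqrt (1 - \<gamma>\<^sup>2 * (deriv v z)\<^sup>2) ^ 3 * deriv (deriv v) z =
     deriv v z * (\<gamma> * (deriv (deriv v) z / sqrt (1 - \<gamma>\<^sup>2 * (deriv v z)\<^sup>2) ^ 3))" by simp
  finally show ?thesis unfolding v''_eq by (simp add: E_def[abs_def])
qed

text \<open>By the mean value theorem \<open>v'\<close> equals the increment \<open>v (z + 1) - v z\<close>
  somewhere in \<open>(z, z + 1)\<close>, and on that interval the energy varies by at most a constant times
  the increment of \<open>v\<close>. So the energy is controlled by the increment, which vanishes at both
  ends of the line.\<close>

lemma E_le_unit_step:
  "E z \<le> energy \<gamma> (v (z + 1) - v z) + (\<bar>c\<bar> / \<gamma> + k) * (v (z + 1) - v z)"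
proof -
  define B where "B = \<bar>c\<bar> / \<gamma> + k"
  obtain x where x: "z < x" "x < z + 1" "v (z + 1) - v z = deriv v x"
    using MVT2[of z "z + 1" v "deriv v"] v_has_derivative by auto
  have "E z + B * v z \<le> E x + B * v x"
  proof (rule DERIV_nonneg_imp_nondecreasing[of z x "\<lambda>t. E t + B * v t"])
    fix t
    have "c * deriv v t - f (v t) \<ge> - B"
    proof -
      have "\<bar>c\<bar> * deriv v t \<le> \<bar>c\<bar> * (1 / \<gamma>)" by (intro mult_left_mono v'_le) auto
      moreover have "- (c * deriv v t) \<le> \<bar>c\<bar> * deriv v t"
        using v'_nonneg[of t] by (metis abs_ge_minus_self abs_mult abs_of_nonneg)
      ultimately show ?thesis using f_le_k[OF v_range[of t]] by (simp add: B_def)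
    qed
    then have "deriv v t * (c * deriv v t - f (v t)) + B * deriv v t \<ge> 0"
      using v'_nonneg[of t] by (simp flip: distrib_left add: mult.commute[of B])
    moreover have "((\<lambda>t. E t + B * v t) has_real_derivative
        deriv v t * (c * deriv v t - f (v t)) + B * deriv v t) (at t)"
      by (intro DERIV_add DERIV_cmult E_has_derivative v_has_derivative)
    ultimately show "\<exists>y. ((\<lambda>t. E t + B * v t) has_real_derivative y) (at t) \<and> 0 \<le> y" by blast
  qed (use x in simp)
  moreover have "E x = energy \<gamma> (v (z + 1) - v z)" by (simp add: E_def x(3))
  moreover have "B * v x \<le> B * v (z + 1)"
    using x gamma_pos k_pos by (intro mult_left_mono monoD[OF v_mono]) (auto simp: B_def)
  ultimately have "E z \<le> energy \<gamma> (v (z + 1) - v z) + (B * v (z + 1) - B * v z)" by linarith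
  then show ?thesis by (simp only: B_def right_diff_distrib)
qed

lemma E_tendsto_zero:
  assumes "(v \<longlongrightarrow> l) F" "((\<lambda>z. v (z + 1)) \<longlongrightarrow> l) F"
  shows "(E \<longlongrightarrow> 0) F"
proof (rule tendsto_sandwich[of "\<lambda>_. 0" _ _ "\<lambda>z. energy \<gamma> (v (z + 1) - v z) + (\<bar>c\<bar> / \<gamma> + k) * (v (z + 1) - v z)"])
  have d: "((\<lambda>z. v (z + 1) - v z) \<longlongrightarrow> 0) F" using tendsto_diff[OF assms(2,1)] by simp
  have "isCont (energy \<gamma>) 0"
    by (rule DERIV_isCont[OF energy_has_derivative]) (use gamma_pos in auto)
  from isCont_tendsto_compose[OF this d]
  have "((\<lambda>z. energy \<gamma> (v (z + 1) - v z)) \<longlongrightarrow> 0) F" by simp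
  from tendsto_add[OF this tendsto_mult_right_zero[OF d, of "\<bar>c\<bar> / \<gamma> + k"]]
  show "((\<lambda>z. energy \<gamma> (v (z + 1) - v z) + (\<bar>c\<bar> / \<gamma> + k) * (v (z + 1) - v z)) \<longlongrightarrow> 0) F" by simp
qed (auto simp: E_nonneg E_le_unit_step)

lemma E_at_bot: "(E \<longlongrightarrow> 0) at_bot"
proof (rule E_tendsto_zero[OF v_at_bot])
  have "filterlim (\<lambda>z::real. z + 1) at_bot at_bot"
    unfolding filterlim_at_bot
  proof
    fix Z :: real
    show "eventually (\<lambda>z. z + 1 \<le> Z) at_bot"
      using eventually_le_at_bot[of "Z - 1"] by eventually_elim simp
  qed
  from filterlim_compose[OF v_at_bot this] show "((\<lambda>z. v (z + 1)) \<longlongrightarrow> 0) at_bot" .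
qed

lemma E_at_top: "(E \<longlongrightarrow> 0) at_top"
proof (rule E_tendsto_zero[OF v_at_top])
  have "filterlim (\<lambda>z::real. z + 1) at_top at_top"
    unfolding filterlim_at_top
  proof
    fix Z :: real
    show "eventually (\<lambda>z. Z \<le> z + 1) at_top"
      using eventually_ge_at_top[of "Z - 1"] by eventually_elim simp
  qed
  from filterlim_compose[OF v_at_top this] show "((\<lambda>z. v (z + 1)) \<longlongrightarrow> 1) at_top" .
qed

end

section \<open>Speed bounds and the profile of a front\<close>

lemma constant_if_nonincreasing_and_limits:
  fixes P :: "real \<Rightarrow> real"
  assumes "\<And>x y. x \<le> y \<Longrightarrow> P y \<le> P x" "(P \<longlongrightarrow> a) at_bot" "(P \<longlongrightarrow> b) at_top" "a \<le> b"
  shows "P z = a"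
proof (rule antisym)
  have "eventually (\<lambda>x. P z \<le> P x) at_bot"
    using eventually_le_at_bot[of z] by eventually_elim (rule assms(1))
  then show "P z \<le> a" by (intro tendsto_lowerbound[OF assms(2)]) auto
  have "eventually (\<lambda>x. P x \<le> P z) at_top"
    using eventually_ge_at_top[of z] by eventually_elim (rule assms(1))
  then have "b \<le> P z" by (intro tendsto_upperbound[OF assms(3)]) auto
  then show "a \<le> P z" using assms(4) by simp
qed

text \<open>The first order reduction: the energy \<open>y\<close> of a front, regarded as a function of the
  value \<open>u\<close> of the front. It solves a scalar equation on \<open>(0, 1)\<close> and vanishes at
  both end points.\<close>

definition profile :: "(real \<Rightarrow> real) \<Rightarrow> real \<Rightarrow> real \<Rightarrow> (real \<Rightarrow> real) \<Rightarrow> bool" where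
  "profile f \<gamma> c y \<longleftrightarrow> continuous_on {0..1} y \<and> y 0 = 0 \<and> y 1 = 0 \<and>
    (\<forall>u\<in>{0<..<1}. y u > 0 \<and> (y has_real_derivative c * slope \<gamma> (y u) - f u) (at u))"

context front
begin

lemma potential_v_has_derivative:
  "((\<lambda>z. potential (v z)) has_real_derivative f (v z) * deriv v z) (at z)"
proof (rule DERIV_image_chain[of potential, unfolded o_def])
  show "(potential has_real_derivative f (v z)) (at (v z) within range v)"
    by (rule DERIV_subset[OF potential_has_derivative[OF v_range]]) (use v_range in auto)
qed (rule v_has_derivative)

lemma potential_v_at_bot: "((\<lambda>z. potential (v z)) \<longlongrightarrow> 0) at_bot"
  using continuous_on_tendsto_compose[OF continuous_on_potential v_at_bot] v_range
  by (simp add: eventually_mono)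

lemma potential_v_at_top: "((\<lambda>z. potential (v z)) \<longlongrightarrow> potential 1) at_top"
  using continuous_on_tendsto_compose[OF continuous_on_potential v_at_top] v_range
  by (simp add: eventually_mono)

text \<open>The sum of kinetic and potential energy. Its derivative is \<open>c v'\<^sup>2\<close>, and it
  goes from \<open>0\<close> at \<open>-\<infinity>\<close> to the mass of \<open>f\<close> at
  \<open>+\<infinity>\<close>; this determines the sign of the speed.\<close>
definition P :: "real \<Rightarrow> real" where "P z = E z + potential (v z)"

lemma P_has_derivative: "(P has_real_derivative c * (deriv v z)\<^sup>2) (at z)"
  using DERIV_add[OF E_has_derivative potential_v_has_derivative]
  by (simp add: P_def[abs_def] algebra_simps power2_eq_square)

lemma P_at_bot: "(P \<longlongrightarrow> 0) at_bot"
  using tendsto_add[OF E_at_bot potential_v_at_bot] by (simp add: P_def[abs_def])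

lemma P_at_top: "(P \<longlongrightarrow> potential 1) at_top"
  using tendsto_add[OF E_at_top potential_v_at_top] by (simp add: P_def[abs_def])

lemma v_not_constant: "\<exists>z. deriv v z \<noteq> 0"
proof (rule ccontr)
  assume "\<not> ?thesis"
  then have "\<forall>z. (v has_real_derivative 0) (at z)" using v_has_derivative by metis
  then have "v = (\<lambda>_. v 0)" using DERIV_isconst_all by blast
  then obtain a where v: "v = (\<lambda>_. a)" by blast
  have "a = 0" "a = 1" using v_at_bot v_at_top by (simp_all add: v tendsto_const_iff)
  then show False by simp
qed

lemma P_not_constant:
  assumes "c \<noteq> 0" shows "\<exists>z. P z \<noteq> 0"
proof (rule ccontr)
  assume "\<not> ?thesis"
  then have "P = (\<lambda>_. 0)" by auto
  then have "c * (deriv v z)\<^sup>2 = 0" for z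
    using P_has_derivative[of z] DERIV_unique[OF _ DERIV_const] by metis
  then show False using v_not_constant assms by auto
qed

lemma speed_nonneg: "c \<ge> 0"
proof (rule ccontr)
  assume c: "\<not> c \<ge> 0"
  have "P z = 0" for z
  proof (rule constant_if_nonincreasing_and_limits[OF _ P_at_bot P_at_top])
    show "P y \<le> P x" if "x \<le> y" for x y
      by (rule DERIV_nonpos_imp_nonincreasing[OF that])
        (use c in \<open>auto intro!: exI P_has_derivative mult_nonpos_nonneg\<close>)
    show "0 \<le> potential 1" using mass_nonneg by (simp add: potential_def)
  qed
  then show False using P_not_constant c by auto
qed

lemma P_mono: "x \<le> y \<Longrightarrow> P x \<le> P y"
  using P_has_derivative speed_nonneg
  by (metis DERIV_nonneg_imp_nondecreasing mult_nonneg_nonneg zero_le_power2)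

lemma speed_zero_if_mass_zero:
  assumes "integral {0..1} f = 0" shows "c = 0"
proof -
  have 0: "potential 1 = 0" using assms by (simp add: potential_def)
  have "(\<lambda>z. - P z) z = -0" for z
    using tendsto_minus[OF P_at_bot] tendsto_minus[OF P_at_top] 0
    by (intro constant_if_nonincreasing_and_limits[of "\<lambda>z. - P z" "-0" 0]) (auto intro: P_mono)
  then show ?thesis using P_not_constant by force
qed

lemma E_le_mass: "E z \<le> potential 1 - potential (v z)"
proof -
  have "eventually (\<lambda>x. P z \<le> P x) at_top"
    using eventually_ge_at_top[of z] by eventually_elim (rule P_mono)
  then have "P z \<le> potential 1" by (intro tendsto_lowerbound[OF P_at_top]) auto
  then show ?thesis by (simp add: P_def)
qed

text \<open>Since \<open>v' \<le> 1 / \<gamma>\<close>, the total energy grows at most as fast as \<open>(c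
  / \<gamma>) v\<close>. Hence \<open>Q\<close> is nonincreasing, and comparing its limits at
  \<open>\<plusminus>\<infinity>\<close> gives \<open>c \<ge> \<gamma> * integral {0..1} f\<close>.\<close>

definition Q :: "real \<Rightarrow> real" where "Q z = P z - c / \<gamma> * v z"

lemma Q_antimono:
  assumes "x \<le> y" shows "Q y \<le> Q x"
proof (rule DERIV_nonpos_imp_nonincreasing[OF assms])
  fix z
  have "(Q has_real_derivative c * (deriv v z)\<^sup>2 - c / \<gamma> * deriv v z) (at z)"
    unfolding Q_def[abs_def] by (intro DERIV_diff DERIV_cmult P_has_derivative v_has_derivative)
  moreover have "c * (deriv v z * deriv v z) \<le> c * (1 / \<gamma> * deriv v z)"
    by (intro mult_left_mono mult_right_mono v'_le v'_nonneg speed_nonneg)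
  ultimately show "\<exists>D. (Q has_real_derivative D) (at z) \<and> D \<le> 0"
    by (auto simp: power2_eq_square)
qed

lemma Q_at_bot: "(Q \<longlongrightarrow> 0) at_bot"
  using tendsto_diff[OF P_at_bot tendsto_mult_right_zero[OF v_at_bot, of "c / \<gamma>"]]
  by (simp add: Q_def[abs_def])

lemma Q_at_top: "(Q \<longlongrightarrow> potential 1 - c / \<gamma>) at_top"
  using tendsto_diff[OF P_at_top tendsto_mult[OF tendsto_const v_at_top, of "c / \<gamma>"]]
  by (simp add: Q_def[abs_def])

lemma Q_nonpos: "Q z \<le> 0"
proof -
  have "eventually (\<lambda>x. Q z \<le> Q x) at_bot"
    using eventually_le_at_bot[of z] by eventually_elim (rule Q_antimono)
  then show "Q z \<le> 0" by (intro tendsto_lowerbound[OF Q_at_bot]) auto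
qed

lemma E_le_speed: "E z \<le> c / \<gamma> * v z - potential (v z)"
  using Q_nonpos[of z] by (simp add: Q_def P_def)

lemma speed_ge: "c \<ge> \<gamma> * integral {0..1} f"
proof -
  have "potential 1 - c / \<gamma> \<le> 0"
    by (rule tendsto_upperbound[OF Q_at_top]) (auto simp: Q_nonpos)
  then show ?thesis using gamma_pos by (simp add: potential_def field_simps)
qed

text \<open>A front is strictly increasing at every level strictly between \<open>0\<close> and
  \<open>1\<close>. At a critical point where \<open>f (v z) > 0\<close> the equation gives \<open>v'' <
  0\<close>, whereas \<open>v'\<close> has a minimum there. At a critical point with \<open>v z \<le>
  \<alpha>\<close> the energy is nondecreasing up to \<open>z\<close> and vanishes at \<open>z\<close>, so
  \<open>v\<close> is constant to the left of \<open>z\<close>, contrary to its limit \<open>0\<close>. No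
  uniqueness theorem for the second order equation is needed.\<close>

lemma v'_pos:
  assumes "0 < v z" "v z < 1"
  shows "deriv v z > 0"
proof (rule ccontr)
  assume "\<not> ?thesis"
  then have z: "deriv v z = 0" using v'_nonneg[of z] by simp
  show False
  proof (cases "v z \<le> \<alpha>")
    case False
    have "deriv (deriv v) z = 0"
      by (rule DERIV_local_min[OF v'_has_derivative, of 1]) (auto simp: z v'_nonneg)
    then have "f (v z) = 0" using v''_eq[of z] z by simp
    then show False using f_pos[of "v z"] False assms by simp
  next
    case True
    have "E x = 0" if "x \<le> z" for x
    proof -
      have "E x \<le> E z"
      proof (rule DERIV_nonneg_imp_nondecreasing[OF that])
        fix t assume "t \<le> z"
        then have "v t \<le> \<alpha>" using v_mono True by (meson monoD order.trans)
        then have "f (v t) \<le> 0" using v_range[of t] by (intro f_nonpos) auto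
        then have "deriv v t * (c * deriv v t - f (v t)) \<ge> 0"
          using v'_nonneg[of t] speed_nonneg by (intro mult_nonneg_nonneg) (auto simp: order_trans[of _ 0])
        then show "\<exists>y. (E has_real_derivative y) (at t) \<and> 0 \<le> y" using E_has_derivative by blast
      qed
      also have "E z = 0" by (simp add: E_def z)
      finally show ?thesis using E_nonneg[of x] by simp
    qed
    then have 0: "deriv v x = 0" if "x \<le> z" for x using slope_E[of x] that by simp
    have "v x = v z" if "x \<le> z" for x
    proof -
      have "v z \<le> v x"
        by (rule DERIV_nonpos_imp_nonincreasing[OF that]) (use v_has_derivative 0 in force)
      then show ?thesis using monoD[OF v_mono that] by (rule antisym[rotated])
    qed
    then have "eventually (\<lambda>x. v x = v z) at_bot"
      by (rule eventually_mono[OF eventually_le_at_bot])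
    then have "(v \<longlongrightarrow> v z) at_bot" by (rule tendsto_eventually)
    then have "v z = 0" by (rule tendsto_unique[OF trivial_limit_at_bot_linorder _ v_at_bot])
    then show False using assms by simp
  qed
qed

lemma ex_level:
  assumes "0 < u" "u < 1" shows "\<exists>z. v z = u"
proof -
  have "eventually (\<lambda>z. v z < u) at_bot" "eventually (\<lambda>z. v z > u) at_top"
    using order_tendstoD v_at_bot v_at_top assms by blast+
  then obtain a b where ab: "v a < u" "v b > u"
    by (meson eventually_happens trivial_limit_at_bot_linorder trivial_limit_at_top_linorder)
  then have "a \<le> b" using v_mono by (metis leD le_cases monoD order_less_trans)
  moreover have "continuous_on {a..b} v"
    using v_has_derivative by (meson DERIV_isCont continuous_at_imp_continuous_on)
  ultimately show ?thesis using IVT'[of v a u b] ab by auto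
qed

text \<open>The position at which the front takes the value \<open>u\<close>, unique for \<open>0 < u <
  1\<close>.\<close>

definition level :: "real \<Rightarrow> real" where "level u = (SOME z. v z = u)"

lemma v_level: "0 < u \<Longrightarrow> u < 1 \<Longrightarrow> v (level u) = u"
  unfolding level_def by (rule someI_ex) (rule ex_level)

lemma level_v:
  assumes "0 < v z" "v z < 1" shows "level (v z) = z"
proof (rule ccontr)
  assume ne: "level (v z) \<noteq> z"
  define a b where "a = min z (level (v z))" and "b = max z (level (v z))"
  have ab: "a < b" "v a = v z" "v b = v z"
    using ne v_level[OF assms] by (auto simp: a_def b_def min_def max_def)
  have "v a < v b"
  proof (rule DERIV_pos_imp_increasing[OF ab(1)])
    fix x assume x: "a \<le> x" "x \<le> b"
    then have "v x = v z" using ab v_mono by (metis monoD order_antisym)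
    then show "\<exists>y. (v has_real_derivative y) (at x) \<and> 0 < y"
      using v'_pos[of x] v_has_derivative assms by auto
  qed
  then show False using ab by simp
qed

lemma level_has_derivative:
  assumes "0 < u" "u < 1"
  shows "(level has_real_derivative inverse (deriv v (level u))) (at u)"
proof -
  have cont: "continuous_on UNIV v"
    using v_has_derivative by (meson DERIV_isCont continuous_at_imp_continuous_on)
  let ?S = "v -` {0<..<1}"
  have "(level has_derivative (*) (inverse (deriv v (level u)))) (at u)"
  proof (rule has_derivative_inverse_strong_x[of ?S level u v])
    show "open ?S" using cont by (intro open_vimage) auto
    show "continuous_on ?S v" using cont by (rule continuous_on_subset) auto
    show "(v has_derivative (*) (deriv v (level u))) (at (level u))"
      using v_has_derivative by (simp add: has_field_derivative_def)
    show "(*) (deriv v (level u)) \<circ> (*) (inverse (deriv v (level u))) = id"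
      using v'_pos[of "level u"] v_level assms by (auto simp: fun_eq_iff)
  qed (use v_level assms level_v in auto)
  then show ?thesis by (simp add: has_field_derivative_def)
qed

text \<open>Every front yields a profile. Continuity of the profile at the end points follows from the two
  energy bounds, also if the front were to reach \<open>0\<close> or \<open>1\<close> at a finite
  position.\<close>

lemma ex_profile: "\<exists>y. profile f \<gamma> c y"
proof -
  define y where "y u = (if 0 < u \<and> u < 1 then E (level u) else 0)" for u
  have dy: "(y has_real_derivative c * slope \<gamma> (y u) - f u) (at u)" if u: "0 < u" "u < 1" for u
  proof -
    let ?z = "level u"
    have p: "deriv v ?z > 0" using v'_pos[of ?z] v_level[OF u] u by simp
    have "((\<lambda>u. E (level u)) has_real_derivative
        deriv v ?z * (c * deriv v ?z - f (v ?z)) * inverse (deriv v ?z)) (at u)"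
      by (rule DERIV_chain2 E_has_derivative level_has_derivative u)+
    also have "deriv v ?z * (c * deriv v ?z - f (v ?z)) * inverse (deriv v ?z) = c * slope \<gamma> (y u) - f u"
      using p u by (simp add: v_level y_def slope_E)
    finally show ?thesis
      by (rule has_field_derivative_transform_within_open[of _ _ _ "{0<..<1}"])
        (use u in \<open>auto simp: y_def\<close>)
  qed
  have pos: "y u > 0" if "0 < u" "u < 1" for u
  proof -
    have "E (level u) \<noteq> 0" using slope_E[of "level u"] v'_pos[of "level u"] v_level that by auto
    then show ?thesis using E_nonneg[of "level u"] that by (simp add: y_def)
  qed
  have y_nonneg: "y u \<ge> 0" for u by (simp add: y_def E_nonneg)
  have le1: "y u \<le> c / \<gamma> * u - potential u" if "u \<in> {0..<1}" for u
    using E_le_speed[of "level u"] that by (auto simp: y_def v_level)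
  have le2: "y u \<le> potential 1 - potential u" if "u \<in> {0<..1}" for u
    using E_le_mass[of "level u"] that by (auto simp: y_def v_level)
  have "isCont y u" if "0 < u" "u < 1" for u using dy[OF that] by (rule DERIV_isCont)
  moreover have "(y \<longlongrightarrow> 0) (at 0 within {0..1})"
  proof (rule tendsto_sandwich[of "\<lambda>_. 0" _ _ "\<lambda>u. c / \<gamma> * u - potential u"])
    have "((\<lambda>u. c / \<gamma> * u - potential u) \<longlongrightarrow> c / \<gamma> * 0 - potential 0) (at 0 within {0..1})"
      by (intro tendsto_intros continuous_on_potential[unfolded continuous_on_def, rule_format]) auto
    then show "((\<lambda>u. c / \<gamma> * u - potential u) \<longlongrightarrow> 0) (at 0 within {0..1})" by simp
    have "eventually (\<lambda>u::real. u < 1) (at 0 within {0..1})"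
      by (rule order_tendstoD(2)[OF tendsto_ident_at]) simp
    moreover have "eventually (\<lambda>u::real. u \<in> {0..1}) (at 0 within {0..1})"
      by (simp add: eventually_at_filter)
    ultimately show "\<forall>\<^sub>F u in at 0 within {0..1}. y u \<le> c / \<gamma> * u - potential u"
      by eventually_elim (use le1 in auto)
  qed (auto simp: y_nonneg)
  moreover have "(y \<longlongrightarrow> 0) (at 1 within {0..1})"
  proof (rule tendsto_sandwich[of "\<lambda>_. 0" _ _ "\<lambda>u. potential 1 - potential u"])
    have "((\<lambda>u. potential 1 - potential u) \<longlongrightarrow> potential 1 - potential 1) (at 1 within {0..1})"
      by (intro tendsto_intros continuous_on_potential[unfolded continuous_on_def, rule_format]) auto
    then show "((\<lambda>u. potential 1 - potential u) \<longlongrightarrow> 0) (at 1 within {0..1})" by simp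
    have "eventually (\<lambda>u::real. u > 0) (at 1 within {0..1})"
      by (rule order_tendstoD(1)[OF tendsto_ident_at]) simp
    moreover have "eventually (\<lambda>u::real. u \<in> {0..1}) (at 1 within {0..1})"
      by (simp add: eventually_at_filter)
    ultimately show "\<forall>\<^sub>F u in at 1 within {0..1}. y u \<le> potential 1 - potential u"
      by eventually_elim (use le2 in auto)
  qed (auto simp: y_nonneg)
  ultimately have "continuous_on {0..1} y"
    unfolding continuous_on_def
  proof (intro ballI)
    fix u :: real assume u: "u \<in> {0..1}"
    then consider "u = 0" | "u = 1" | "0 < u" "u < 1" by fastforce
    then show "(y \<longlongrightarrow> y u) (at u within {0..1})"
    proof cases
      case 3
      then show ?thesis using dy[OF 3] DERIV_isCont continuous_at_imp_continuous_at_within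
        by (metis continuous_within)
    qed (use \<open>(y \<longlongrightarrow> 0) (at 0 within {0..1})\<close> \<open>(y \<longlongrightarrow> 0) (at 1 within {0..1})\<close> in \<open>auto simp: y_def\<close>)
  qed
  then show ?thesis unfolding profile_def using dy pos by (intro exI[of _ y]) (auto simp: y_def)
qed

end

section \<open>Comparison and construction of profiles\<close>

lemma profileD:
  assumes "profile f \<gamma> c y"
  shows "continuous_on {0..1} y" "y 0 = 0" "y 1 = 0"
    and "\<And>u. 0 < u \<Longrightarrow> u < 1 \<Longrightarrow> y u > 0"
    and "\<And>u. 0 < u \<Longrightarrow> u < 1 \<Longrightarrow> (y has_real_derivative c * slope \<gamma> (y u) - f u) (at u)"
  using assms by (auto simp: profile_def)

lemma backward_comparison:
  fixes y1 y2 D1 D2 :: "real \<Rightarrow> real"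
  assumes "continuous_on {0..1} y1" "continuous_on {0..1} y2" "y1 1 \<le> y2 1"
    and d1: "\<And>u. 0 < u \<Longrightarrow> u < 1 \<Longrightarrow> (y1 has_real_derivative D1 u) (at u)"
    and d2: "\<And>u. 0 < u \<Longrightarrow> u < 1 \<Longrightarrow> (y2 has_real_derivative D2 u) (at u)"
    and D: "\<And>u. 0 < u \<Longrightarrow> u < 1 \<Longrightarrow> y2 u < y1 u \<Longrightarrow> D2 u \<le> D1 u"
    and "u \<in> {0..1}"
  shows "y1 u \<le> y2 u"
proof -
  have "y1 u - y2 u \<le> 0"
  proof (rule nonpos_if_nondecreasing_where_pos[of 0 1 "\<lambda>u. y1 u - y2 u" u])
    show "continuous_on {0..1} (\<lambda>u. y1 u - y2 u)" using assms by (intro continuous_intros)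
    fix x :: real assume x: "0 < x" "x < 1" "0 < y1 x - y2 x"
    then have "D1 x - D2 x \<ge> 0" using D[of x] by simp
    then show "\<exists>D\<ge>0. ((\<lambda>u. y1 u - y2 u) has_real_derivative D) (at x)"
      using DERIV_diff[OF d1[OF x(1,2)] d2[OF x(1,2)]] by blast
  qed (use assms in auto)
  then show ?thesis by simp
qed

text \<open>Comparison from the end point \<open>1\<close>: the larger the drift term, the smaller the
  profile.\<close>

lemma profile_antimono:
  assumes "profile f \<gamma>1 c1 y1" "profile f \<gamma>2 c2 y2" "\<gamma>1 > 0" "c1 \<ge> 0"
    and le: "\<And>y. y > 0 \<Longrightarrow> c2 * slope \<gamma>2 y \<le> c1 * slope \<gamma>1 y"
    and "u \<in> {0..1}"
  shows "y1 u \<le> y2 u"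
proof (rule backward_comparison[OF profileD(1)[OF assms(1)] profileD(1)[OF assms(2)] _
      profileD(5)[OF assms(1)] profileD(5)[OF assms(2)]])
  show "y1 1 \<le> y2 1" using assms(1,2) by (simp add: profile_def)
  fix x :: real assume x: "0 < x" "x < 1" "y2 x < y1 x"
  have p: "y2 x > 0" using profileD(4)[OF assms(2)] x by simp
  have "c2 * slope \<gamma>2 (y2 x) \<le> c1 * slope \<gamma>1 (y2 x)" by (rule le[OF p])
  also have "\<dots> \<le> c1 * slope \<gamma>1 (y1 x)" using assms x p by (intro mult_left_mono slope_mono) auto
  finally show "c2 * slope \<gamma>2 (y2 x) - f x \<le> c1 * slope \<gamma>1 (y1 x) - f x" by simp
qed (use assms in auto)

lemma sqrt_profile_has_derivative:
  assumes "profile f \<gamma> c y" "0 < u" "u < 1"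
  shows "((\<lambda>u. sqrt (y u)) has_real_derivative (c * slope \<gamma> (y u) / sqrt (y u) - f u / sqrt (y u)) / 2) (at u)"
proof -
  have "y u > 0" using assms profileD(4) by blast
  from DERIV_chain2[OF DERIV_real_sqrt[OF this] profileD(5)[OF assms]]
  show ?thesis
    by (rule DERIV_cong) (simp add: diff_divide_distrib right_diff_distrib inverse_eq_divide)
qed

text \<open>If \<open>f \<le> 0\<close> near \<open>0\<close>, comparison from the end point
  \<open>0\<close> gives the opposite inequality near \<open>0\<close>. It is carried out for the square
  roots of the profiles, since \<open>slope \<gamma> y / sqrt y\<close> is nonincreasing in
  \<open>y\<close>. The two profiles then coincide near \<open>0\<close>, although their drift terms
  differ.\<close>

lemma profiles_speed_comparison:
  assumes "profile f \<gamma>1 c1 y1" "profile f \<gamma>2 c2 y2" "\<gamma>1 > 0" "\<gamma>2 > 0" "c1 \<ge> 0"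
    and less: "\<And>y. y > 0 \<Longrightarrow> c2 * slope \<gamma>2 y < c1 * slope \<gamma>1 y"
    and \<alpha>: "0 < \<alpha>" "\<alpha> < 1" and f: "\<And>u. 0 < u \<Longrightarrow> u < \<alpha> \<Longrightarrow> f u \<le> 0"
  shows False
proof -
  note P1 = profileD[OF assms(1)] and P2 = profileD[OF assms(2)]
  have le: "y1 u \<le> y2 u" if "u \<in> {0..1}" for u
    by (rule profile_antimono[OF assms(1-3,5) less_imp_le[OF less] that])
  have ge: "y2 u \<le> y1 u" if u: "0 < u" "u < \<alpha>" for u
  proof -
    have "sqrt (y1 0) - sqrt (y2 0) \<le> sqrt (y1 u) - sqrt (y2 u)"
    proof (rule DERIV_nonneg_imp_increasing_open[of 0 u "\<lambda>u. sqrt (y1 u) - sqrt (y2 u)"])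
      show "continuous_on {0..u} (\<lambda>u. sqrt (y1 u) - sqrt (y2 u))"
        using u \<alpha> by (intro continuous_intros continuous_on_subset[OF P1(1)] continuous_on_subset[OF P2(1)]) auto
      fix x assume x: "0 < x" "x < u"
      then have x1: "0 < x" "x < 1" "x < \<alpha>" using u \<alpha> by auto
      have p: "y1 x > 0" "y1 x \<le> y2 x" using P1(4) le x1 by auto
      have "c2 * slope \<gamma>2 (y2 x) / sqrt (y2 x) \<le> c1 * slope \<gamma>1 (y2 x) / sqrt (y2 x)"
        using less[of "y2 x"] p by (intro divide_right_mono) auto
      also have "\<dots> \<le> c1 * slope \<gamma>1 (y1 x) / sqrt (y1 x)"
        using mult_left_mono[OF slope_div_sqrt_antimono[OF assms(3) p] assms(5)] by simp
      finally have a: "c2 * slope \<gamma>2 (y2 x) / sqrt (y2 x) \<le> c1 * slope \<gamma>1 (y1 x) / sqrt (y1 x)" .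
      have "- f x / sqrt (y2 x) \<le> - f x / sqrt (y1 x)"
        using f[OF x1(1,3)] p by (intro divide_left_mono) auto
      then have b: "f x / sqrt (y1 x) \<le> f x / sqrt (y2 x)" by simp
      have "(c1 * slope \<gamma>1 (y1 x) / sqrt (y1 x) - f x / sqrt (y1 x)) / 2
          - (c2 * slope \<gamma>2 (y2 x) / sqrt (y2 x) - f x / sqrt (y2 x)) / 2 \<ge> 0"
      proof -
        have "(a1 - b1) / 2 - (a2 - b2) / 2 \<ge> 0" if "a2 \<le> a1" "b1 \<le> b2" for a1 a2 b1 b2 :: real
          using that by simp
        then show ?thesis using a b .
      qed
      then show "\<exists>D. ((\<lambda>u. sqrt (y1 u) - sqrt (y2 u)) has_real_derivative D) (at x) \<and> 0 \<le> D"
        using DERIV_diff[OF sqrt_profile_has_derivative[OF assms(1) x1(1,2)]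
            sqrt_profile_has_derivative[OF assms(2) x1(1,2)]] by blast
    qed (use u in simp)
    then show ?thesis using P1(2) P2(2) by simp
  qed
  \<comment> \<open>Any point of \<open>(0, \<alpha>)\<close> would do.\<close>
  define u where "u = \<alpha> / 2"
  have u: "0 < u" "u < \<alpha>" "u < 1" using \<alpha> by (auto simp: u_def)
  have eq: "y1 x = y2 x" if "x \<in> {0<..<\<alpha>}" for x
    by (rule antisym[OF le ge]) (use that \<alpha> in auto)
  have "(y2 has_real_derivative c1 * slope \<gamma>1 (y1 u) - f u) (at u)"
    by (rule has_field_derivative_transform_within_open[OF P1(5)[OF u(1,3)], of "{0<..<\<alpha>}"])
      (use u eq in auto)
  then have "c1 * slope \<gamma>1 (y1 u) - f u = c2 * slope \<gamma>2 (y2 u) - f u"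
    using P2(5)[OF u(1,3)] by (rule DERIV_unique)
  then show False using less[of "y2 u"] P2(4)[OF u(1,3)] eq[of u] u by simp
qed

text \<open>If \<open>f > 0\<close> on \<open>(0, 1)\<close>, speeds are not unique, and the comparison of
  critical speeds requires the construction of a profile. A profile for a smaller drift term is a barrier:
  the equation is solved backwards from \<open>y 1 = 0\<close>, in which direction it reads \<open>u' = q -
  G u\<close> with nondecreasing \<open>G\<close>; positivity of \<open>f\<close> keeps the solution
  positive on \<open>(0, 1)\<close>, and the barrier forces it to vanish at \<open>0\<close>.\<close>

lemma ex_profile_of_subsolution:
  assumes f_cont: "continuous_on {0..1} f" and f_pos: "\<And>u. 0 < u \<Longrightarrow> u < 1 \<Longrightarrow> f u > 0"
    and sub: "profile f \<gamma>2 c2 y2" and "\<gamma> > 0" "c \<ge> 0"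
    and le: "\<And>y. y > 0 \<Longrightarrow> c2 * slope \<gamma>2 y \<le> c * slope \<gamma> y"
  shows "\<exists>y. profile f \<gamma> c y"
proof -
  define G where "G y = c * slope \<gamma> (max y 0)" for y
  have G_mono: "G x \<le> G y" if "x \<le> y" for x y
    unfolding G_def using that assms by (intro mult_left_mono slope_mono) auto
  have slope_close: "\<bar>slope \<gamma> x - slope \<gamma> y\<bar> \<le> sqrt (2 / \<gamma>) * sqrt \<bar>x - y\<bar>" if "x \<ge> 0" "y \<ge> 0" for x y
    using slope_dist_le[OF \<open>\<gamma> > 0\<close>, of x y] slope_dist_le[OF \<open>\<gamma> > 0\<close>, of y x]
      slope_mono[OF \<open>\<gamma> > 0\<close>, of x y] slope_mono[OF \<open>\<gamma> > 0\<close>, of y x] that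
    by (cases "x \<le> y") (auto simp: abs_minus_commute)
  \<comment> \<open>The summand \<open>1\<close> only ensures \<open>C > 0\<close>.\<close>
  define C where "C = c * sqrt (2 / \<gamma>) + 1"
  have C: "C > 0" unfolding C_def using assms by (intro add_nonneg_pos mult_nonneg_nonneg) auto
  have mod: "\<bar>c * slope \<gamma> x - c * slope \<gamma> y\<bar> \<le> C * sqrt \<bar>x - y\<bar>" if "x \<ge> 0" "y \<ge> 0" for x y
  proof -
    have "\<bar>c * slope \<gamma> x - c * slope \<gamma> y\<bar> = c * \<bar>slope \<gamma> x - slope \<gamma> y\<bar>"
      using \<open>c \<ge> 0\<close> by (simp add: abs_mult flip: right_diff_distrib)
    also have "\<dots> \<le> c * (sqrt (2 / \<gamma>) * sqrt \<bar>x - y\<bar>)"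
      using \<open>c \<ge> 0\<close> slope_close[OF that] by (intro mult_left_mono)
    also have "\<dots> \<le> C * sqrt \<bar>x - y\<bar>" by (simp add: C_def algebra_simps)
    finally show ?thesis .
  qed
  have root: "C * sqrt ((e / C)\<^sup>2) = e" if "e > 0" for e using that C by simp
  have "uniformly_continuous_on UNIV G"
    unfolding uniformly_continuous_on_def
  proof (intro allI impI)
    fix e :: real assume e: "e > 0"
    show "\<exists>d>0. \<forall>x\<in>UNIV. \<forall>x'\<in>UNIV. dist x' x < d \<longrightarrow> dist (G x') (G x) < e"
    proof (intro exI[of _ "(e / C)\<^sup>2"] conjI ballI impI)
      fix x y :: real assume d: "dist y x < (e / C)\<^sup>2"
      have "\<bar>G y - G x\<bar> \<le> C * sqrt \<bar>max y 0 - max x 0\<bar>" unfolding G_def by (rule mod) auto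
      also have "\<dots> \<le> C * sqrt \<bar>y - x\<bar>" using C by (intro mult_left_mono real_sqrt_le_mono) auto
      also have "\<dots> < C * sqrt ((e / C)\<^sup>2)"
        using C d by (intro mult_strict_left_mono real_sqrt_less_mono) (auto simp: dist_real_def)
      finally show "dist (G y) (G x) < e" using root[OF e] by (simp add: dist_real_def)
    qed (use e C in auto)
  qed
  moreover have "\<exists>H L. mono H \<and> L-lipschitz_on UNIV H \<and> (\<forall>x. \<bar>H x - G x\<bar> \<le> e)" if e: "e > 0" for e
  proof -
    define \<epsilon> where "\<epsilon> = (e / C)\<^sup>2"
    have \<epsilon>: "\<epsilon> > 0" using e C by (simp add: \<epsilon>_def)
    \<comment> \<open>Shifting the argument away from \<open>0\<close> makes the nonlinearity Lipschitz.\<close>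
    define H where "H y = c * slope \<gamma> (max y 0 + \<epsilon>)" for y
    have "mono H"
      unfolding H_def by (intro monoI mult_left_mono slope_mono) (use assms \<epsilon> in auto)
    moreover have "(c / (\<gamma> * slope \<gamma> \<epsilon>))-lipschitz_on UNIV H"
    proof (rule lipschitz_onI)
      fix x y :: real
      have "dist (H x) (H y) = c * \<bar>slope \<gamma> (max x 0 + \<epsilon>) - slope \<gamma> (max y 0 + \<epsilon>)\<bar>"
        using \<open>c \<ge> 0\<close> by (simp add: H_def dist_real_def abs_mult flip: right_diff_distrib)
      also have "\<dots> \<le> c * (1 / (\<gamma> * slope \<gamma> \<epsilon>) * \<bar>(max x 0 + \<epsilon>) - (max y 0 + \<epsilon>)\<bar>)"
        using assms \<epsilon> by (intro mult_left_mono slope_lipschitz) auto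
      also have "\<dots> \<le> c * (1 / (\<gamma> * slope \<gamma> \<epsilon>) * \<bar>x - y\<bar>)"
        using assms \<epsilon> slope_pos[of \<gamma> \<epsilon>] by (intro mult_left_mono) auto
      finally show "dist (H x) (H y) \<le> c / (\<gamma> * slope \<gamma> \<epsilon>) * dist x y" by (simp add: dist_real_def)
    qed (use assms \<epsilon> slope_pos[of \<gamma> \<epsilon>] in auto)
    moreover have "\<bar>H x - G x\<bar> \<le> e" for x
    proof -
      have "\<bar>H x - G x\<bar> \<le> C * sqrt \<bar>(max x 0 + \<epsilon>) - max x 0\<bar>"
        unfolding H_def G_def using \<epsilon> by (intro mod) auto
      also have "\<dots> = e" using \<epsilon> root[OF e] by (simp add: \<epsilon>_def)
      finally show ?thesis .
    qed
    ultimately show ?thesis by blast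
  qed
  moreover have "continuous_on {0..1} (\<lambda>t. f (1 - t))"
    by (rule continuous_on_compose2[OF f_cont]) (auto intro!: continuous_intros)
  ultimately obtain u where u0: "u 0 = 0"
    and du: "\<And>t. t \<in> {0..1} \<Longrightarrow> (u has_real_derivative f (1 - t) - G (u t)) (at t within {0..1})"
    using monotone_ode_unit_interval[of "\<lambda>t. f (1 - t)" G] by blast
  have uc: "continuous_on {0..1} u" using du by (rule DERIV_continuous_on)
  have du': "(u has_real_derivative f (1 - t) - G (u t)) (at t)" if "0 < t" "t < 1" for t
    using du[of t] that by (simp add: at_within_Icc_at)
  have G0: "G x = 0" if "x \<le> 0" for x using that by (simp add: G_def max_def)
  have u_nonneg: "u t \<ge> 0" if "t \<in> {0..1}" for t
  proof -
    have "- u t \<le> 0"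
    proof (rule nonpos_if_nonincreasing_where_pos[of 0 1 "\<lambda>t. - u t" t])
      fix x :: real assume x: "0 < x" "x < 1" "0 < - u x"
      then have "- (f (1 - x) - G (u x)) \<le> 0" using f_pos[of "1 - x"] G0[of "u x"] by simp
      then show "\<exists>D\<le>0. ((\<lambda>t. - u t) has_real_derivative D) (at x)"
        using DERIV_minus[OF du'[OF x(1,2)]] by blast
    qed (use that u0 uc in \<open>auto intro: continuous_intros\<close>)
    then show ?thesis by simp
  qed
  have u_pos: "u t > 0" if t: "0 < t" "t < 1" for t
  proof (rule ccontr)
    assume "\<not> u t > 0"
    then have z: "u t = 0" using u_nonneg[of t] t by simp
    have "f (1 - t) - G (u t) = 0"
    proof (rule DERIV_local_min[OF du'[OF t], of "min t (1 - t)"])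
      show "\<forall>y. \<bar>t - y\<bar> < min t (1 - t) \<longrightarrow> u t \<le> u y"
        using z t by (auto intro!: u_nonneg)
    qed (use t in auto)
    then show False using f_pos[of "1 - t"] t z G0[of 0] by simp
  qed
  define y where "y x = u (1 - x)" for x
  have yc: "continuous_on {0..1} y"
    unfolding y_def by (rule continuous_on_compose2[OF uc]) (auto intro!: continuous_intros)
  have dy: "(y has_real_derivative c * slope \<gamma> (y x) - f x) (at x)" if x: "0 < x" "x < 1" for x
  proof -
    have 1: "((\<lambda>x. 1 - x) has_real_derivative - 1) (at x)" by (auto intro!: derivative_eq_intros)
    have "((\<lambda>x. u (1 - x)) has_real_derivative (f (1 - (1 - x)) - G (u (1 - x))) * - 1) (at x)"
      by (rule DERIV_chain2[OF _ 1]) (use du'[of "1 - x"] x in simp)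
    then show ?thesis using u_pos[of "1 - x"] x by (simp add: y_def[abs_def] G_def)
  qed
  have pos: "y x > 0" if "0 < x" "x < 1" for x using that u_pos by (simp add: y_def)
  have "y 0 \<le> y2 0"
  proof (rule backward_comparison[OF yc profileD(1)[OF sub] _ dy profileD(5)[OF sub]])
    show "y 1 \<le> y2 1" using u0 profileD(3)[OF sub] by (simp add: y_def)
    fix x :: real assume x: "0 < x" "x < 1" "y2 x < y x"
    have p: "y2 x > 0" using profileD(4)[OF sub] x by simp
    have "c2 * slope \<gamma>2 (y2 x) \<le> c * slope \<gamma> (y2 x)" by (rule le[OF p])
    also have "\<dots> \<le> c * slope \<gamma> (y x)" using assms x p by (intro mult_left_mono slope_mono) auto
    finally show "c2 * slope \<gamma>2 (y2 x) - f x \<le> c * slope \<gamma> (y x) - f x" by simp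
  qed auto
  then have "y 0 = 0" using profileD(2)[OF sub] u_nonneg[of 1] by (simp add: y_def)
  then show ?thesis using yc dy pos u0 by (intro exI[of _ y]) (auto simp: profile_def y_def)
qed

section \<open>From profiles to fronts\<close>

text \<open>The orbit is the inverse of \<open>Z\<close>, a primitive of \<open>1 / W\<close>. The linear
  bounds on \<open>W\<close> at \<open>0\<close> and \<open>1\<close> make \<open>Z\<close> diverge at least
  logarithmically there, so that \<open>Z\<close> maps \<open>(0, 1)\<close> onto the line.\<close>

lemma ex_connecting_orbit:
  fixes W :: "real \<Rightarrow> real"
  assumes cont: "\<And>x. 0 < x \<Longrightarrow> x < 1 \<Longrightarrow> isCont W x"
    and pos: "\<And>x. 0 < x \<Longrightarrow> x < 1 \<Longrightarrow> W x > 0"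
    and A: "A > 0" "\<And>x. 0 < x \<Longrightarrow> x < 1 \<Longrightarrow> W x \<le> A * x"
    and B: "B > 0" "\<And>x. 0 < x \<Longrightarrow> x < 1 \<Longrightarrow> W x \<le> B * (1 - x)"
  shows "\<exists>v. (\<forall>z. v z \<in> {0<..<1} \<and> (v has_real_derivative W (v z)) (at z)) \<and>
    mono v \<and> (v \<longlongrightarrow> 0) at_bot \<and> (v \<longlongrightarrow> 1) at_top"
proof -
  have "isCont (\<lambda>x. 1 / W x) x" if "0 < x" "x < 1" for x
    using cont[OF that] pos[OF that] by (intro continuous_intros) auto
  then obtain Z where "\<And>x. 0 < x \<Longrightarrow> x < 1 \<Longrightarrow> (Z has_vector_derivative 1 / W x) (at x)"
    using einterval_antiderivative[of 0 1 "\<lambda>x. 1 / W x"] by (auto simp: zero_ereal_def one_ereal_def)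
  then have dZ: "(Z has_real_derivative 1 / W x) (at x)" if "0 < x" "x < 1" for x
    using that by (simp add: has_real_derivative_iff_has_vector_derivative)
  have Zc: "continuous_on {a..b} Z" if "0 < a" "b < 1" for a b
    using dZ that by (intro continuous_at_imp_continuous_on ballI DERIV_isCont[OF dZ]) auto
  have Z_less: "Z a < Z b" if "0 < a" "a < b" "b < 1" for a b
    by (rule DERIV_pos_imp_increasing[OF that(2)])
      (use that dZ pos in \<open>meson divide_pos_pos less_le_trans le_less_trans zero_less_one\<close>)
  have surj: "\<exists>x. 0 < x \<and> x < 1 \<and> Z x = t" for t
  proof -
    \<comment> \<open>The points \<open>a\<close> and \<open>b\<close> are those at which the logarithmic bounds for \<open>Z\<close> have moved by \<open>d\<close> from \<open>Z (1/2)\<close>.\<close>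
    define d where "d = \<bar>t - Z (1/2)\<bar>"
    define a where "a = exp (- (A * d)) / 2"
    define b where "b = 1 - exp (- (B * d)) / 2"
    have e: "exp (- (A * d)) \<le> 1" "exp (- (B * d)) \<le> 1" "exp (- (A * d)) > 0" "exp (- (B * d)) > 0"
      using A(1) B(1) by (auto simp: d_def)
    have ab: "0 < a" "a \<le> 1/2" "1/2 \<le> b" "b < 1" using e unfolding a_def b_def by linarith+
    have lnab: "ln a = - (A * d) + ln (1/2)" "ln (1 - b) = - (B * d) + ln (1/2)"
      by (simp_all add: a_def b_def ln_div)
    have "Z a - ln a / A \<le> Z (1/2) - ln (1/2) / A"
    proof (rule DERIV_nonneg_imp_nondecreasing[OF ab(2)])
      fix x assume x: "a \<le> x" "x \<le> 1/2"
      then have x1: "0 < x" "x < 1" using ab by auto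
      have "1 / (A * x) \<le> 1 / W x" using A x1 pos by (intro divide_left_mono) auto
      then have "1 / W x - 1 / x / A \<ge> 0" by (simp add: mult.commute)
      moreover have "((\<lambda>x. Z x - ln x / A) has_real_derivative 1 / W x - 1 / x / A) (at x)"
        by (intro DERIV_diff dZ x1 DERIV_cdivide DERIV_ln_divide)
      ultimately show "\<exists>D. ((\<lambda>x. Z x - ln x / A) has_real_derivative D) (at x) \<and> 0 \<le> D" by blast
    qed
    then have "Z a \<le> Z (1/2) - d" using A(1) by (simp add: lnab diff_divide_distrib)
    then have 1: "Z a \<le> t" by (simp add: d_def)
    have "Z (1/2) + ln (1 - 1/2) / B \<le> Z b + ln (1 - b) / B"
    proof (rule DERIV_nonneg_imp_nondecreasing[OF ab(3)])
      fix x assume x: "1/2 \<le> x" "x \<le> b"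
      then have x1: "0 < x" "x < 1" using ab by auto
      have "1 / (B * (1 - x)) \<le> 1 / W x" using B x1 pos by (intro divide_left_mono) auto
      then have "1 / W x + 1 / (1 - x) * (- 1) / B \<ge> 0" by (simp add: mult.commute)
      moreover have "((\<lambda>x. Z x + ln (1 - x) / B) has_real_derivative 1 / W x + 1 / (1 - x) * (- 1) / B) (at x)"
      proof (intro DERIV_add dZ x1 DERIV_cdivide)
        have "((\<lambda>x. 1 - x) has_real_derivative - 1) (at x)" by (auto intro!: derivative_eq_intros)
        then show "((\<lambda>x. ln (1 - x)) has_real_derivative 1 / (1 - x) * (- 1)) (at x)"
          by (rule DERIV_chain2[where f = ln, rotated]) (use x1 in \<open>auto intro: DERIV_ln_divide\<close>)
      qed
      ultimately show "\<exists>D. ((\<lambda>x. Z x + ln (1 - x) / B) has_real_derivative D) (at x) \<and> 0 \<le> D" by blast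
    qed
    then have "Z (1/2) + d \<le> Z b" using B(1) by (simp add: lnab diff_divide_distrib)
    then have 2: "t \<le> Z b" by (simp add: d_def)
    obtain x where "a \<le> x" "x \<le> b" "Z x = t"
      using IVT'[of Z a t b] 1 2 Zc[OF ab(1,4)] ab by auto
    then show ?thesis using ab by (intro exI[of _ x]) auto
  qed
  then obtain v where v: "\<And>t. 0 < v t" "\<And>t. v t < 1" "\<And>t. Z (v t) = t" by metis
  have vZ: "v (Z x) = x" if x: "0 < x" "x < 1" for x
    using v(1,2,3)[of "Z x"] Z_less[of "v (Z x)" x] Z_less[of x "v (Z x)"] x by (cases "v (Z x)" x rule: linorder_cases) auto
  have dv: "(v has_real_derivative W (v t)) (at t)" for t
  proof -
    have p: "W (v t) > 0" using pos v by blast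
    have "(v has_derivative (*) (W (v t))) (at t)"
    proof (rule has_derivative_inverse_strong_x[of "{0<..<1}" v t Z])
      show "continuous_on {0<..<1} Z"
        using dZ by (intro continuous_at_imp_continuous_on ballI DERIV_isCont[OF dZ]) auto
      show "(Z has_derivative (*) (1 / W (v t))) (at (v t))"
        using dZ[OF v(1,2)] by (simp add: has_field_derivative_def)
      show "(*) (1 / W (v t)) \<circ> (*) (W (v t)) = id" using p by (auto simp: fun_eq_iff)
    qed (use v vZ in auto)
    then show ?thesis by (simp add: has_field_derivative_def)
  qed
  have mono: "v x \<le> v y" if "x \<le> y" for x y
  proof (rule DERIV_nonneg_imp_nondecreasing[OF that])
    fix t
    have "W (v t) \<ge> 0" using pos[OF v(1,2)] by (rule less_imp_le)
    then show "\<exists>D. (v has_real_derivative D) (at t) \<and> 0 \<le> D" using dv by blast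
  qed
  have "(v \<longlongrightarrow> 0) at_bot"
  proof (rule order_tendstoI)
    fix e :: real assume "e > 0"
    then have e: "0 < min (e/2) (1/2)" "min (e/2) (1/2) < 1" "min (e/2) (1/2) < e" by auto
    have "eventually (\<lambda>z. v z \<le> min (e/2) (1/2)) at_bot"
      using eventually_le_at_bot[of "Z (min (e/2) (1/2))"]
      by eventually_elim (use mono vZ[OF e(1,2)] in metis)
    then show "eventually (\<lambda>z. v z < e) at_bot" by (rule eventually_mono) (rule le_less_trans[OF _ e(3)])
  qed (simp add: less_trans[OF _ v(1)])
  moreover have "(v \<longlongrightarrow> 1) at_top"
  proof (rule order_tendstoI)
    fix e :: real assume "e < 1"
    then have e: "0 < max ((1 + e)/2) (1/2)" "max ((1 + e)/2) (1/2) < 1" "e < max ((1 + e)/2) (1/2)"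
      by (auto simp: less_max_iff_disj)
    have "eventually (\<lambda>z. v z \<ge> max ((1 + e)/2) (1/2)) at_top"
      using eventually_ge_at_top[of "Z (max ((1 + e)/2) (1/2))"]
      by eventually_elim (use mono vZ[OF e(1,2)] in metis)
    then show "eventually (\<lambda>z. e < v z) at_top" by (rule eventually_mono) (rule less_le_trans[OF e(3)])
  qed (simp add: less_trans[OF v(2)])
  ultimately show ?thesis using v dv mono by (intro exI[of _ v]) (auto intro: monoI)
qed

text \<open>Conversely, a profile yields a front by integrating \<open>v' = slope \<gamma> (y v)\<close>.
  The bounds \<open>sqrt (y u) \<le> K u\<close> and \<open>y u \<le> k (1 - u)\<^sup>2 / 2\<close> give the
  linear bounds on the right-hand side.\<close>

lemma heteroclinic_of_profile:
  assumes f_cont: "continuous_on {0..1} f" and f_nonneg: "\<And>u. 0 < u \<Longrightarrow> u < 1 \<Longrightarrow> 0 \<le> f u"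
    and f_bound: "\<And>u. 0 < u \<Longrightarrow> u < 1 \<Longrightarrow> f u \<le> k * (1 - u)" and "k > 0"
    and prof: "profile f \<gamma> c y" and gamma: "\<gamma> > 0" and c: "c \<ge> 0"
  shows "\<exists>v. heteroclinic f \<gamma> c v"
proof -
  have yc: "continuous_on {0..1} y" and y0: "y 0 = 0" and y1: "y 1 = 0"
    and y_pos: "\<And>u. 0 < u \<Longrightarrow> u < 1 \<Longrightarrow> y u > 0"
    and dy: "\<And>u. 0 < u \<Longrightarrow> u < 1 \<Longrightarrow> (y has_real_derivative c * slope \<gamma> (y u) - f u) (at u)"
    using prof by (auto simp: profile_def)
  define W where "W x = slope \<gamma> (y x)" for x
  \<comment> \<open>The summand \<open>1\<close> only ensures \<open>K > 0\<close>.\<close>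
  define K where "K = c * sqrt (2 / \<gamma>) / 2 + 1"
  have K: "K > 0" unfolding K_def using c gamma by (intro add_nonneg_pos divide_nonneg_nonneg mult_nonneg_nonneg) auto
  have W_pos: "W x > 0" if "0 < x" "x < 1" for x
    unfolding W_def by (rule slope_pos[OF gamma y_pos[OF that]])
  have y_le0: "sqrt (y x) \<le> K * x" if x: "0 < x" "x < 1" for x
  proof -
    have "K * 0 - sqrt (y 0) \<le> K * x - sqrt (y x)"
    proof (rule DERIV_nonneg_imp_increasing_open[of 0 x "\<lambda>x. K * x - sqrt (y x)"])
      show "continuous_on {0..x} (\<lambda>x. K * x - sqrt (y x))"
        using x by (intro continuous_intros continuous_on_subset[OF yc]) auto
      fix t assume "0 < t" "t < x"
      then have t: "0 < t" "t < 1" using x by auto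
      have p: "sqrt (y t) > 0" using y_pos[OF t] by simp
      have "inverse (sqrt (y t)) / 2 * (c * slope \<gamma> (y t) - f t) \<le> inverse (sqrt (y t)) / 2 * (c * (sqrt (2 / \<gamma>) * sqrt (y t)))"
        using p f_nonneg[OF t] mult_left_mono[OF slope_le_sqrt[OF gamma less_imp_le[OF y_pos[OF t]]] c]
        by (intro mult_left_mono) auto
      also have "\<dots> = c * sqrt (2 / \<gamma>) / 2"
      proof -
        have "inverse r / 2 * (c * (b * r)) = c * b / 2" if "r > 0" for r b :: real
          using that by (simp add: field_simps)
        then show ?thesis using p .
      qed
      also have "\<dots> \<le> K" by (simp add: K_def)
      finally have "K * 1 - inverse (sqrt (y t)) / 2 * (c * slope \<gamma> (y t) - f t) \<ge> 0" by simp
      moreover have "((\<lambda>x. K * x - sqrt (y x)) has_real_derivative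
          K * 1 - inverse (sqrt (y t)) / 2 * (c * slope \<gamma> (y t) - f t)) (at t)"
        by (intro DERIV_diff DERIV_cmult DERIV_ident DERIV_chain2[where f = sqrt] DERIV_real_sqrt y_pos dy t)
      ultimately show "\<exists>D. ((\<lambda>x. K * x - sqrt (y x)) has_real_derivative D) (at t) \<and> 0 \<le> D" by blast
    qed (use x in simp)
    then show ?thesis by (simp add: y0)
  qed
  have y_le1: "y x \<le> k * (1 - x)\<^sup>2 / 2" if x: "0 < x" "x < 1" for x
  proof -
    have "y x - k * (1 - x)\<^sup>2 / 2 \<le> y 1 - k * (1 - 1)\<^sup>2 / 2"
    proof (rule DERIV_nonneg_imp_increasing_open[of x 1 "\<lambda>x. y x - k * (1 - x)\<^sup>2 / 2"])
      show "continuous_on {x..1} (\<lambda>x. y x - k * (1 - x)\<^sup>2 / 2)"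
        using x by (intro continuous_intros continuous_on_subset[OF yc]) auto
      fix t assume "x < t" "t < 1"
      then have t: "0 < t" "t < 1" using x by auto
      have "c * slope \<gamma> (y t) \<ge> 0" using c slope_nonneg[OF gamma less_imp_le[OF y_pos[OF t]]] by simp
      then have "(c * slope \<gamma> (y t) - f t) - (- (k * (1 - t))) \<ge> 0" using f_bound[OF t] by simp
      moreover have "((\<lambda>x. k * (1 - x)\<^sup>2 / 2) has_real_derivative - (k * (1 - t))) (at t)"
        by (auto intro!: derivative_eq_intros simp: field_simps)
      ultimately show "\<exists>D. ((\<lambda>x. y x - k * (1 - x)\<^sup>2 / 2) has_real_derivative D) (at t) \<and> 0 \<le> D"
        using DERIV_diff[OF dy[OF t]] by blast
    qed (use x in simp)
    then show ?thesis by (simp add: y1)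
  qed
  have slope_sqrt: "W x \<le> sqrt (2 / \<gamma>) * b" if "0 < x" "x < 1" "sqrt (y x) \<le> b" for x b
  proof -
    have "W x \<le> sqrt (2 / \<gamma>) * sqrt (y x)"
      unfolding W_def by (rule slope_le_sqrt[OF gamma less_imp_le[OF y_pos[OF that(1,2)]]])
    also have "\<dots> \<le> sqrt (2 / \<gamma>) * b" using that gamma by (intro mult_left_mono) auto
    finally show ?thesis .
  qed
  have "\<exists>v. (\<forall>z. v z \<in> {0<..<1} \<and> (v has_real_derivative W (v z)) (at z)) \<and>
    mono v \<and> (v \<longlongrightarrow> 0) at_bot \<and> (v \<longlongrightarrow> 1) at_top"
  proof (rule ex_connecting_orbit[where A = "sqrt (2 / \<gamma>) * K" and B = "sqrt (2 / \<gamma>) * sqrt (k / 2)"])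
    fix x :: real assume x: "0 < x" "x < 1"
    show "isCont W x" unfolding W_def
      by (rule isCont_o2[OF DERIV_isCont[OF dy[OF x]] DERIV_isCont[OF slope_has_derivative[OF gamma y_pos[OF x]]]])
    show "W x \<le> sqrt (2 / \<gamma>) * K * x" using slope_sqrt[OF x y_le0[OF x]] by (simp add: mult.assoc)
    have "sqrt (y x) \<le> sqrt (k / 2) * (1 - x)"
      using real_sqrt_le_mono[OF y_le1[OF x]] x by (simp add: real_sqrt_mult real_sqrt_divide)
    from slope_sqrt[OF x this] show "W x \<le> sqrt (2 / \<gamma>) * sqrt (k / 2) * (1 - x)" by (simp add: mult.assoc)
  qed (use W_pos K gamma \<open>k > 0\<close> in auto)
  then obtain v where v: "\<And>z. 0 < v z" "\<And>z. v z < 1" and dv: "\<And>z. (v has_real_derivative W (v z)) (at z)"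
    and lim: "mono v" "(v \<longlongrightarrow> 0) at_bot" "(v \<longlongrightarrow> 1) at_top" by auto
  have v': "deriv v = (\<lambda>z. W (v z))" using dv by (auto intro!: DERIV_imp_deriv)
  define p where "p z = 1 + \<gamma> * y (v z)" for z
  have yv: "y (v z) > 0" for z using y_pos v by blast
  have p: "p z > 1" for z using yv[of z] gamma by (simp add: p_def)
  define N where "N z = c * W (v z) - f (v z)" for z
  have dv': "(deriv v has_real_derivative N z / (\<gamma> * p z ^ 3)) (at z)" for z
  proof -
    have "((\<lambda>z. slope \<gamma> (y (v z))) has_real_derivative
       1 / (\<gamma> * (1 + \<gamma> * y (v z)) ^ 3 * slope \<gamma> (y (v z))) * ((c * slope \<gamma> (y (v z)) - f (v z)) * W (v z))) (at z)"
      by (rule DERIV_chain2[where f = "slope \<gamma>"] slope_has_derivative gamma yv DERIV_chain2[where f = y] dy v dv)+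
    moreover have "W (v z) > 0" using W_pos v by blast
    ultimately show ?thesis unfolding v' N_def p_def W_def by simp
  qed
  have v'': "deriv (deriv v) = (\<lambda>z. N z / (\<gamma> * p z ^ 3))" using dv' by (auto intro!: DERIV_imp_deriv)
  have vc: "continuous_on UNIV v"
    by (intro continuous_at_imp_continuous_on ballI DERIV_isCont[OF dv])
  have comp: "continuous_on UNIV (\<lambda>z. g (v z))" if "continuous_on {0..1} g" for g :: "real \<Rightarrow> real"
    by (rule continuous_on_compose2[OF that vc]) (auto simp: less_imp_le[OF v(1)] less_imp_le[OF v(2)])
  have Wc: "continuous_on UNIV (\<lambda>z. W (v z))"
    unfolding v'[symmetric] by (intro continuous_at_imp_continuous_on ballI DERIV_isCont[OF dv'])
  have p_nz: "1 + \<gamma> * y (v z) \<noteq> 0" for z using p[of z] by (simp add: p_def)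
  have "continuous_on UNIV (deriv (deriv v))"
    unfolding v'' N_def p_def using gamma p_nz
    by (intro continuous_intros Wc comp f_cont yc) auto
  then have "C2 v" unfolding C2_def using dv dv' by (auto simp: real_differentiable_def)
  moreover have sub: "\<gamma> * \<bar>deriv v z\<bar> < 1" for z
    using slope_less[OF gamma less_imp_le[OF yv[of z]]] slope_nonneg[OF gamma less_imp_le[OF yv[of z]]]
    by (simp add: v' W_def)
  moreover have "\<gamma> * deriv (\<lambda>x. deriv v x / sqrt (1 - \<gamma>\<^sup>2 * (deriv v x)\<^sup>2)) z - c * deriv v z + f (v z) = 0" for z
  proof -
    have "deriv (\<lambda>x. deriv v x / sqrt (1 - \<gamma>\<^sup>2 * (deriv v x)\<^sup>2)) z
        = 1 / sqrt (1 - \<gamma>\<^sup>2 * (deriv v z)\<^sup>2) ^ 3 * (N z / (\<gamma> * p z ^ 3))"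
      by (rule DERIV_imp_deriv DERIV_chain2 flux_has_derivative gamma sub dv')+
    also have "1 - \<gamma>\<^sup>2 * (deriv v z)\<^sup>2 = (1 / p z)\<^sup>2"
      using slope_sq[OF gamma less_imp_le[OF yv[of z]]]
      by (simp add: v' W_def p_def power_mult_distrib power_divide)
    also have "sqrt ((1 / p z)\<^sup>2) = 1 / p z" using p[of z] by simp
    also have "1 / (1 / p z) ^ 3 * (N z / (\<gamma> * p z ^ 3)) = N z / \<gamma>"
      using p[of z] gamma by (simp add: power_divide)
    finally show ?thesis using gamma by (simp add: N_def v')
  qed
  ultimately show ?thesis unfolding heteroclinic_def
    using lim less_imp_le[OF v(1)] less_imp_le[OF v(2)] by (intro exI[of _ v]) auto
qed

section \<open>Asymptotics for large \<gamma>\<close>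

lemma (in front) v_lipschitz: "\<bar>v z - v 0\<bar> \<le> \<bar>z\<bar> / \<gamma>"
proof -
  have "norm (v z - v 0) \<le> 1 / \<gamma> * norm (z - 0)"
    by (rule field_differentiable_bound[of UNIV v "deriv v"])
      (auto simp: v_has_derivative v'_nonneg v'_le)
  then show ?thesis by simp
qed

lemma uniform_limit_if_order_inverse:
  fixes g :: "real \<Rightarrow> 'a \<Rightarrow> real"
  assumes "\<forall>\<^sub>F \<gamma> in at_top. \<forall>x\<in>K. \<bar>g \<gamma> x - h x\<bar> \<le> M / \<gamma>"
  shows "uniform_limit K g h at_top"
proof (rule uniform_limitI)
  fix e :: real assume "e > 0"
  have "((\<lambda>\<gamma>. M / \<gamma>) \<longlongrightarrow> 0) at_top"
    by (rule tendsto_divide_0[OF tendsto_const filterlim_at_top_imp_at_infinity[OF filterlim_ident]])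
  from order_tendstoD(2)[OF this \<open>e > 0\<close>] assms
  show "\<forall>\<^sub>F \<gamma> in at_top. \<forall>x\<in>K. dist (g \<gamma> x) (h x) < e"
    by eventually_elim (auto simp: dist_real_def intro: le_less_trans)
qed

theorem theorem19:
  fixes f :: "real \<Rightarrow> real" and k V0 :: real
    and c :: "real \<Rightarrow> real" and v :: "real \<Rightarrow> real \<Rightarrow> real"
  assumes f_cont: "continuous_on {0..1} f"
    and f_type: "(type_A f \<and> V0 = 1/2) \<or> type_B f V0 \<or> type_C f V0"
    and f_ends: "f 0 = 0" "f 1 = 0"
    and k_pos: "k > 0"
    and f_bounds: "\<forall>s\<in>{0..1}. \<bar>f s\<bar> \<le> k * s \<and> \<bar>f s\<bar> \<le> k * (1 - s)"
    and c_critical: "\<forall>\<gamma>>0. critical_speed f \<gamma> (c \<gamma>)"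
    and v_heteroclinic: "\<forall>\<gamma>>0. heteroclinic f \<gamma> (c \<gamma>) (v \<gamma>) \<and> v \<gamma> 0 = V0"
  shows "(integral {0..1} f > 0 \<longrightarrow>
            filterlim c at_top at_top \<and>
            mono_on {0<..} c \<and>
            (\<exists>C1 C2. 0 < C1 \<and> C1 \<le> C2 \<and>
               (\<forall>\<^sub>F \<gamma> in at_top. C1 * \<gamma> \<le> c \<gamma> \<and> c \<gamma> \<le> C2 * \<gamma>)))
       \<and> (integral {0..1} f = 0 \<longrightarrow> (c \<longlongrightarrow> 0) at_top)
       \<and> C2_loc_limit v (\<lambda>_. V0) at_top"
proof -
  define \<alpha> where "\<alpha> = (if type_A f then 0 else V0)"
  have \<alpha>: "0 \<le> \<alpha>" "\<alpha> < 1"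
    using f_type by (auto simp: \<alpha>_def type_B_def type_C_def)
  have pos: "f u > 0" if "\<alpha> < u" "u < 1" for u
    using f_type that by (auto simp: \<alpha>_def type_A_def type_B_def type_C_def split: if_splits)
  have nonpos: "f u \<le> 0" if u: "0 \<le> u" "u \<le> \<alpha>" for u
  proof (cases "\<alpha> = 0")
    case True
    then show ?thesis using u f_ends by simp
  next
    case False
    have "u \<in> closure {0<..<\<alpha>}" using u False \<alpha>(1) by simp
    then show ?thesis
    proof (rule continuous_le_on_closure[rotated])
      show "continuous_on (closure {0<..<\<alpha>}) f"
        using False \<alpha> by (intro continuous_on_subset[OF f_cont]) auto
      show "f x \<le> 0" if "x \<in> {0<..<\<alpha>}" for x
        using f_type that False by (auto simp: \<alpha>_def type_B_def type_C_def less_imp_le split: if_splits)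
    qed
  qed
  have mass: "integral {0..1} f \<ge> 0"
  proof (cases "type_C f V0")
    case False
    have "f u \<ge> 0" if u: "u \<in> {0..1}" for u
    proof (cases "\<alpha> < u \<and> u < 1")
      case True
      then show ?thesis using pos[of u] by simp
    next
      case out: False
      then have "u = 1 \<or> 0 \<le> u \<and> u \<le> \<alpha>" using u by auto
      then have "f u = 0" using f_type False f_ends u by (auto simp: \<alpha>_def type_B_def split: if_splits)
      then show ?thesis by simp
    qed
    then show ?thesis
      using f_cont by (intro integral_nonneg integrable_continuous_real) auto
  qed (simp add: type_C_def)
  interpret reaction f \<alpha> k
    by unfold_locales (use f_cont \<alpha> pos nonpos mass k_pos f_bounds in auto)
  have front: "front f \<alpha> k \<gamma> (c \<gamma>) (v \<gamma>)" if "\<gamma> > 0" for \<gamma>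
    by unfold_locales (use that v_heteroclinic in auto)
  have c_nonneg: "c \<gamma> \<ge> 0" if "\<gamma> > 0" for \<gamma>
    using front.speed_nonneg[OF front[OF that]] .
  \<comment> \<open>A front at \<open>\<gamma>2\<close> whose drift term is dominated by that of \<open>(\<gamma>1, c1)\<close> bounds the critical speed at \<open>\<gamma>1\<close>.\<close>
  have speed_le: "c \<gamma>1 \<le> c1" if g: "\<gamma>1 > 0" "\<gamma>2 > 0" and c1: "c1 \<ge> 0"
    and le: "\<And>y. y > 0 \<Longrightarrow> c \<gamma>2 * slope \<gamma>2 y \<le> c1 * slope \<gamma>1 y" for \<gamma>1 \<gamma>2 c1
  proof -
    obtain y2 where y2: "profile f \<gamma>2 (c \<gamma>2) y2" using front.ex_profile[OF front[OF g(2)]] ..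
    obtain y1 where y1: "profile f \<gamma>1 (c \<gamma>1) y1" using front.ex_profile[OF front[OF g(1)]] ..
    show ?thesis
    proof (cases "type_A f")
      case True
      then have pos: "\<And>u. 0 < u \<Longrightarrow> u < 1 \<Longrightarrow> f u > 0" by (simp add: type_A_def)
      obtain y where "profile f \<gamma>1 c1 y"
        using ex_profile_of_subsolution[OF f_cont pos y2 g(1) c1 le] by blast
      moreover have "f u \<le> k * (1 - u)" if "0 < u" "u < 1" for u
        using f_bound[of u] that by simp
      ultimately have "c1 \<in> admissible_speeds f \<gamma>1"
        using heteroclinic_of_profile[OF f_cont less_imp_le[OF pos] _ k_pos _ g(1) c1]
        unfolding admissible_speeds_def by blast
      then show ?thesis using c_critical g(1) True by (auto simp: critical_speed_def)
    next
      case False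
      then have \<alpha>_pos: "0 < \<alpha>" using f_type by (auto simp: \<alpha>_def type_B_def type_C_def)
      show ?thesis
      proof (rule ccontr)
        assume *: "\<not> c \<gamma>1 \<le> c1"
        have "c \<gamma>2 * slope \<gamma>2 y < c \<gamma>1 * slope \<gamma>1 y" if "y > 0" for y
          by (rule le_less_trans[OF le[OF that]])
            (use * slope_pos[OF g(1) that] in \<open>simp add: mult_strict_right_mono\<close>)
        from profiles_speed_comparison[OF y1 y2 g c_nonneg[OF g(1)] this \<alpha>_pos threshold(2)]
        show False using f_nonpos by force
      qed
    qed
  qed
  have c_mono: "c \<gamma>1 \<le> c \<gamma>2" if "0 < \<gamma>1" "\<gamma>1 \<le> \<gamma>2" for \<gamma>1 \<gamma>2
    by (rule speed_le[of \<gamma>1 \<gamma>2]) (use that c_nonneg in \<open>auto intro!: mult_left_mono slope_antimono_gamma\<close>)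
  have c_upper: "c \<gamma> \<le> c 1 * \<gamma>" if "\<gamma> \<ge> 1" for \<gamma>
  proof (rule speed_le[of \<gamma> 1])
    fix y :: real assume "y > 0"
    then have "1 * slope 1 y \<le> \<gamma> * slope \<gamma> y" using that by (intro gamma_slope_mono) auto
    then have "c 1 * (1 * slope 1 y) \<le> c 1 * (\<gamma> * slope \<gamma> y)" by (intro mult_left_mono c_nonneg) auto
    then show "c 1 * slope 1 y \<le> c 1 * \<gamma> * slope \<gamma> y" by (simp add: mult.assoc)
  qed (use that c_nonneg[of 1] in auto)
  have c_lower: "integral {0..1} f * \<gamma> \<le> c \<gamma>" if "\<gamma> > 0" for \<gamma>
    using front.speed_ge[OF front[OF that]] by (simp add: mult.commute)
  have pos_mass: "filterlim c at_top at_top \<and> mono_on {0<..} c \<and>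
    (\<exists>C1 C2. 0 < C1 \<and> C1 \<le> C2 \<and> (\<forall>\<^sub>F \<gamma> in at_top. C1 * \<gamma> \<le> c \<gamma> \<and> c \<gamma> \<le> C2 * \<gamma>))"
    if m: "integral {0..1} f > 0"
  proof (intro conjI)
    have "filterlim (\<lambda>\<gamma>. integral {0..1} f * \<gamma>) at_top at_top"
      using m by (intro filterlim_tendsto_pos_mult_at_top[OF tendsto_const _ filterlim_ident])
    then show "filterlim c at_top at_top"
      by (rule filterlim_at_top_mono) (rule eventually_mono[OF eventually_gt_at_top[of 0] c_lower])
    show "mono_on {0<..} c" by (rule mono_onI) (use c_mono in auto)
    have "\<forall>\<^sub>F \<gamma> in at_top. integral {0..1} f * \<gamma> \<le> c \<gamma> \<and> c \<gamma> \<le> c 1 * \<gamma>"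
      using eventually_ge_at_top[of 1] by eventually_elim (use c_lower c_upper in auto)
    then show "\<exists>C1 C2. 0 < C1 \<and> C1 \<le> C2 \<and> (\<forall>\<^sub>F \<gamma> in at_top. C1 * \<gamma> \<le> c \<gamma> \<and> c \<gamma> \<le> C2 * \<gamma>)"
      using m c_lower[of 1] by auto
  qed
  have zero_mass: "(c \<longlongrightarrow> 0) at_top" if m: "integral {0..1} f = 0"
  proof (rule tendsto_eventually)
    show "\<forall>\<^sub>F \<gamma> in at_top. c \<gamma> = 0"
      using eventually_gt_at_top[of 0]
      by eventually_elim (rule front.speed_zero_if_mass_zero[OF front m])
  qed
  have "C2_loc_limit v (\<lambda>_. V0) at_top"
    unfolding C2_loc_limit_def
  proof (intro allI impI conjI)
    fix K :: "real set" assume "compact K"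
    then have "bounded K" by (rule compact_imp_bounded)
    then obtain R where R: "\<And>x. x \<in> K \<Longrightarrow> \<bar>x\<bar> \<le> R" by (auto simp: bounded_iff)
    have "\<bar>v \<gamma> x - V0\<bar> \<le> R / \<gamma>" if "\<gamma> > 0" "x \<in> K" for \<gamma> x
    proof -
      have "\<bar>v \<gamma> x - V0\<bar> \<le> \<bar>x\<bar> / \<gamma>"
        using front.v_lipschitz[OF front[OF that(1)], of x] v_heteroclinic that(1) by simp
      also have "\<dots> \<le> R / \<gamma>" using R that by (simp add: divide_right_mono)
      finally show ?thesis .
    qed
    then show "uniform_limit K v (\<lambda>_. V0) at_top"
      by (intro uniform_limit_if_order_inverse eventually_mono[OF eventually_gt_at_top[of 0]]) blast
    have d: "deriv (\<lambda>_::real. a) = (\<lambda>_. 0)" for a :: real by auto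
    have "\<bar>deriv (v \<gamma>) x - 0\<bar> \<le> 1 / \<gamma>" if "\<gamma> > 0" for \<gamma> x
      using front.v'_nonneg[OF front[OF that], of x] front.v'_le[OF front[OF that], of x] by simp
    then show "uniform_limit K (\<lambda>i. deriv (v i)) (deriv (\<lambda>_. V0)) at_top"
      unfolding d
      by (intro uniform_limit_if_order_inverse eventually_mono[OF eventually_gt_at_top[of 0]]) blast
    have "\<bar>deriv (deriv (v \<gamma>)) x - 0\<bar> \<le> (c 1 + k) / \<gamma>" if "\<gamma> \<ge> 1" for \<gamma> x
    proof -
      have "\<gamma> > 0" using that by simp
      have "\<bar>deriv (deriv (v \<gamma>)) x\<bar> \<le> (\<bar>c \<gamma>\<bar> / \<gamma> + k) / \<gamma>"
        by (rule front.v''_bound[OF front[OF \<open>\<gamma> > 0\<close>]])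
      also have "\<dots> \<le> (c 1 + k) / \<gamma>"
        using c_upper[OF that] c_nonneg[OF \<open>\<gamma> > 0\<close>] \<open>\<gamma> > 0\<close>
        by (intro divide_right_mono add_right_mono) (auto simp: divide_le_eq)
      finally show ?thesis by simp
    qed
    then show "uniform_limit K (\<lambda>i. deriv (deriv (v i))) (deriv (deriv (\<lambda>_. V0))) at_top"
      unfolding d
      by (intro uniform_limit_if_order_inverse eventually_mono[OF eventually_ge_at_top[of 1]]) blast
  qed
  then show ?thesis using pos_mass zero_mass by blast
qed

end
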